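(* Assume (H1)--(H5), and let $\delta_2\in(0,1)$, $\gamma_2>0$, $C_2,R_2<\infty$ be constants for which the cell estimate $\mathbb P(X_R>C_2R^{-\delta_2})\le C_2R^{-\gamma_2}$ holds for all $R\ge R_2$ (see context). For $R>0$ and $1\le i,j\le d$ let $T_R,V_{ij,R}$ solve \[ \begin{cases}-A:D^2T_R=1&\text{in }B_R,\\ T_R=0&\text{on }\partial B_R,\end{cases} \qquad \begin{cases}-A:D^2V_{ij,R}=A_{ij}&\text{in }B_R,\\ V_{ij,R}=0&\text{on }\partial B_R,\end{cases} \] and define $\widehat A_{R,ij}=V_{ij,R}(0)/T_R(0)$. Then \[ \mathbb P(|\widehat A_R-\bar A|>2dC_2R^{-\delta_2})\le C_2R^{-\gamma_2},\qquad R\ge R_2. \]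
   Context: Setting. $d\ge2$; $\mathbb S^d$ is the space of real symmetric $d\times d$ matrices with Frobenius norm $|\cdot|$ and pairing $M:N=\operatorname{tr}(M^{\mathsf T}N)$; $B_R$ is the open ball of radius $R$ about $0$. The probability space is the canonical space of continuous matrix fields $A=A(x,\omega)$ on $\mathbb R^d$, with the locally uniform topology and its Borel $\sigma$-algebra; translations $\tau_z$ satisfy $A(x,\tau_z\omega)=A(x+z,\omega)$; the law is $\mathbb P$ with expectation $\mathbb E$. Assumptions: (H1) Almost surely, for every $x$, $A(x)=A(x)^{\mathsf T}$ and $0<A(x)\le I$. (H2) Every $\tau_z$ preserves $\mathbb P$. (H3) There is $\ell<\infty$ such that $\sigma(A|_U)$ and $\sigma(A|_V)$ are independent whenever $U,V$ are deterministic Borel sets with $\operatorname{dist}(U,V)>\ell$. (H4) For $F(M,x,\omega)=-A(x,\omega):M$, the family $\{F(\cdot,\cdot,\omega)\}_\omega$ is uniformly equicontinuous on $\{|M|\le K\}\times\mathbb R^d$ for every $K<\infty$, and there are a deterministic continuous modulus $\rho$ and $\sigma>1/2$ with $|F(M,x,\omega)-F(M,y,\omega)|\le\rho((1+|M|)|x-y|^\sigma)$. (H5) With $\lambda(x)=\lambda_{\min}(A(x))$ and $\lambda_*(z)=\inf_{B_1(z)}\lambda$, $\mathbb E[\lambda_*(0)^{-d}]<\infty$. $\bar A$ is the deterministic effective matrix, $0<\bar A\le I$, supplied by the known qualitative homogenization theorem (Armstrong--Smart): for each fixed bounded smooth domain $U$ and smooth $f,g$, almost surely the solutions of $-A(x/\varepsilon):D^2u_\varepsilon=f$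 in $U$, $u_\varepsilon=g$ on $\partial U$ converge uniformly to the solution of $-\bar A:D^2u_0=f$, $u_0=g$ on $\partial U$. Cell estimate. $w_{M,R}$ solves $-A:D^2w_{M,R}=(A-\bar A):M$ in $B_R$, $w_{M,R}=0$ on $\partial B_R$, and $X_R=R^{-2}\sup_{|M|\le1}\|w_{M,R}\|_{L^\infty(B_R)}$. Constants $\delta_2,\gamma_2,C_2,R_2$ as in the claim exist under (H1)--(H5) by a separate theorem. In each realization $A$ is Hölder continuous and uniformly elliptic on $\overline{B_R}$, so all these Dirichlet problems have unique classical solutions. *)

theory Defs
  imports "HOL-Probability.Probability"
begin

text \<open>
  \<open>\<real>\<^sup>d\<close> is \<open>real ^ 'n\<close> with \<open>d = CARD('n)\<close>.  On \<open>real ^ 'n ^ 'n\<close> the library's \<open>norm\<close> is the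
  Frobenius norm and the inner product \<open>M \<bullet> N\<close> is \<open>M : N = tr (M\<^sup>T N)\<close>.
\<close>

section \<open>Symmetric matrices\<close>

definition sym_mat :: "(real ^ 'n ^ 'n) set" where
  "sym_mat = {M. transpose M = M}"

definition loewner_le :: "real ^ 'n ^ 'n \<Rightarrow> real ^ 'n ^ 'n \<Rightarrow> bool" where
  "loewner_le M N \<longleftrightarrow> (\<forall>v. v \<bullet> (M *v v) \<le> v \<bullet> (N *v v))"

definition loewner_less :: "real ^ 'n ^ 'n \<Rightarrow> real ^ 'n ^ 'n \<Rightarrow> bool" where
  "loewner_less M N \<longleftrightarrow> (\<forall>v. v \<noteq> 0 \<longrightarrow> v \<bullet> (M *v v) < v \<bullet> (N *v v))"

definition lambda_min :: "real ^ 'n ^ 'n \<Rightarrow> real" where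
  "lambda_min M = Min {c. \<exists>v. v \<noteq> 0 \<and> M *v v = c *\<^sub>R v}"

section \<open>Classical solutions of the Dirichlet problem\<close>

definition partial_deriv :: "'n \<Rightarrow> (real ^ 'n \<Rightarrow> real) \<Rightarrow> real ^ 'n \<Rightarrow> real" where
  "partial_deriv i u x = frechet_derivative u (at x) (axis i 1)"

primrec Ck_on :: "nat \<Rightarrow> (real ^ 'n) set \<Rightarrow> (real ^ 'n \<Rightarrow> real) \<Rightarrow> bool" where
  "Ck_on 0 U u \<longleftrightarrow> continuous_on U u"
| "Ck_on (Suc k) U u \<longleftrightarrow>
     (\<forall>x\<in>U. u differentiable (at x)) \<and> (\<forall>i. Ck_on k U (partial_deriv i u))"

definition smooth_fun_on :: "(real ^ 'n) set \<Rightarrow> (real ^ 'n \<Rightarrow> real) \<Rightarrow> bool" where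
  "smooth_fun_on U u \<longleftrightarrow> (\<forall>k. Ck_on k U u)"

definition hessian :: "(real ^ 'n \<Rightarrow> real) \<Rightarrow> real ^ 'n \<Rightarrow> real ^ 'n ^ 'n" where
  "hessian u x = (\<chi> i j. partial_deriv i (partial_deriv j u) x)"

text \<open>
  \<open>u \<in> C\<^sup>2(U) \<inter> C(closure U)\<close> solves \<open>- a : D\<^sup>2 u = f\<close> in the open set \<open>U\<close>, \<open>u = g\<close> on its boundary.
\<close>

definition dirichlet_solution ::
  "(real ^ 'n \<Rightarrow> real ^ 'n ^ 'n) \<Rightarrow> (real ^ 'n \<Rightarrow> real) \<Rightarrow> (real ^ 'n \<Rightarrow> real) \<Rightarrow>
   (real ^ 'n) set \<Rightarrow> (real ^ 'n \<Rightarrow> real) \<Rightarrow> bool" where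
  "dirichlet_solution a f g U u \<longleftrightarrow>
     Ck_on 2 U u \<and> continuous_on (closure U) u \<and>
     (\<forall>x\<in>U. - (a x \<bullet> hessian u x) = f x) \<and>
     (\<forall>x\<in>frontier U. u x = g x)"

text \<open>Near each boundary point the domain is a sublevel set of a smooth local defining function.\<close>

definition bounded_smooth_domain :: "(real ^ 'n) set \<Rightarrow> bool" where
  "bounded_smooth_domain U \<longleftrightarrow>
     open U \<and> connected U \<and> U \<noteq> {} \<and> bounded U \<and>
     (\<forall>p\<in>frontier U. \<exists>W \<phi>. open W \<and> p \<in> W \<and> smooth_fun_on W \<phi> \<and>
        (\<exists>i. partial_deriv i \<phi> p \<noteq> 0) \<and> \<phi> p = 0 \<and> U \<inter> W = {x \<in> W. \<phi> x < 0})"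

section \<open>The canonical space of continuous matrix fields\<close>

text \<open>
  A realization is the field itself: \<open>A(x, \<omega>)\<close> is \<open>\<omega> x\<close>.
\<close>

type_synonym 'n mfield = "(real, 'n) vec \<Rightarrow> ((real, 'n) vec, 'n) vec"

definition locally_uniform_topology :: "('n::finite) mfield topology" where
  "locally_uniform_topology = topology_generated_by
     {{h. continuous_on UNIV h \<and> (\<forall>x\<in>K. dist (h x) (g x) < e)} | g K e.
        continuous_on UNIV g \<and> compact K \<and> 0 < e}"

definition canonical_law :: "('n::finite) mfield measure \<Rightarrow> bool" where
  "canonical_law P \<longleftrightarrow>
     prob_space P \<and>
     space P = {\<omega>. continuous_on UNIV \<omega>} \<and>
     sets P = sigma_sets {\<omega>. continuous_on UNIV \<omega>} {G. openin locally_uniform_topology G}"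

definition translate :: "real ^ 'n \<Rightarrow> ('n::finite) mfield \<Rightarrow> 'n mfield" where
  "translate z \<omega> = (\<lambda>x. \<omega> (x + z))"

section \<open>Standing assumptions on the law\<close>

definition elliptic_law :: "('n::finite) mfield measure \<Rightarrow> bool" where
  "elliptic_law P \<longleftrightarrow>
     (AE \<omega> in P. \<forall>x. \<omega> x \<in> sym_mat \<and> loewner_less 0 (\<omega> x) \<and> loewner_le (\<omega> x) (mat 1))"

definition stationary_law :: "('n::finite) mfield measure \<Rightarrow> bool" where
  "stationary_law P \<longleftrightarrow> (\<forall>z. translate z \<in> P \<rightarrow>\<^sub>M P \<and> distr P P (translate z) = P)"

definition restriction_sigma :: "('n::finite) mfield measure \<Rightarrow> (real ^ 'n) set \<Rightarrow> 'n mfield set set" where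
  "restriction_sigma P U =
     sigma_sets (space P) {(\<lambda>\<omega>. \<omega> x) -` B \<inter> space P | x B. x \<in> U \<and> B \<in> sets borel}"

text \<open>
  The library sets \<open>setdist\<close> to \<open>0\<close> when one of the sets is empty; this does not matter below, the
  \<open>\<sigma>\<close>-algebra of the empty set being trivial.
\<close>

definition finite_range_law :: "('n::finite) mfield measure \<Rightarrow> bool" where
  "finite_range_law P \<longleftrightarrow>
     (\<exists>l::real. \<forall>U\<in>sets borel. \<forall>V\<in>sets borel. setdist U V > l \<longrightarrow>
        prob_space.indep_set P (restriction_sigma P U) (restriction_sigma P V))"

definition op_F :: "real ^ 'n ^ 'n \<Rightarrow> real ^ 'n \<Rightarrow> ('n::finite) mfield \<Rightarrow> real" where
  "op_F M x \<omega> = - (\<omega> x \<bullet> M)"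

text \<open>
  The conditions are imposed on a set \<open>\<Omega>\<^sub>0\<close> of full probability: on the whole canonical space, which
  contains every continuous field, they cannot hold.  The rates are uniform over \<open>\<Omega>\<^sub>0\<close>.
\<close>

definition regular_law :: "('n::finite) mfield measure \<Rightarrow> bool" where
  "regular_law P \<longleftrightarrow> (\<exists>\<Omega>\<^sub>0. (AE \<omega> in P. \<omega> \<in> \<Omega>\<^sub>0) \<and>
     (\<forall>K. \<forall>e>0. \<exists>\<delta>>0. \<forall>\<omega>\<in>\<Omega>\<^sub>0. \<forall>M\<in>sym_mat. \<forall>N\<in>sym_mat. \<forall>x y.
        norm M \<le> K \<and> norm N \<le> K \<and> dist (M, x) (N, y) < \<delta> \<longrightarrow>
        \<bar>op_F M x \<omega> - op_F N y \<omega>\<bar> < e) \<and>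
     (\<exists>\<rho> \<sigma>. continuous_on {0..} \<rho> \<and> mono_on {0..} \<rho> \<and> \<rho> 0 = 0 \<and> \<sigma> > 1 / 2 \<and>
        (\<forall>\<omega>\<in>\<Omega>\<^sub>0. \<forall>M\<in>sym_mat. \<forall>x y.
           \<bar>op_F M x \<omega> - op_F M y \<omega>\<bar> \<le> \<rho> ((1 + norm M) * norm (x - y) powr \<sigma>))))"

definition lambda_star :: "('n::finite) mfield \<Rightarrow> real ^ 'n \<Rightarrow> real" where
  "lambda_star \<omega> z = (INF x\<in>ball z 1. lambda_min (\<omega> x))"

definition ellipticity_moment :: "('n::finite) mfield measure \<Rightarrow> bool" where
  "ellipticity_moment P \<longleftrightarrow>
     (\<integral>\<^sup>+ \<omega>. inverse (ennreal (lambda_star \<omega> 0)) ^ CARD('n) \<partial>P) < \<infinity>"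

section \<open>The effective matrix and the cell error\<close>

definition effective_matrix :: "('n::finite) mfield measure \<Rightarrow> real ^ 'n ^ 'n \<Rightarrow> bool" where
  "effective_matrix P Abar \<longleftrightarrow>
     Abar \<in> sym_mat \<and> loewner_less 0 Abar \<and> loewner_le Abar (mat 1) \<and>
     (\<forall>U f g. bounded_smooth_domain U \<and> smooth_fun_on UNIV f \<and> smooth_fun_on UNIV g \<longrightarrow>
        (AE \<omega> in P. \<forall>u u\<^sub>0.
           (\<forall>\<epsilon>>0. dirichlet_solution (\<lambda>x. \<omega> (x /\<^sub>R \<epsilon>)) f g U (u \<epsilon>)) \<and>
           dirichlet_solution (\<lambda>_. Abar) f g U u\<^sub>0 \<longrightarrow>
           uniform_limit (closure U) u u\<^sub>0 (at_right 0)))"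

text \<open>
  \<open>w M R \<omega>\<close> stands for the solution \<open>w\<^sub>M\<^sub>,\<^sub>R\<close> in the realization \<open>\<omega>\<close>; it is continuous, so its
  \<open>L\<^sup>\<infinity>\<close> norm is a supremum.
\<close>

definition cell_error ::
  "(real ^ 'n ^ 'n \<Rightarrow> real \<Rightarrow> ('n::finite) mfield \<Rightarrow> real ^ 'n \<Rightarrow> real) \<Rightarrow> real \<Rightarrow> 'n mfield \<Rightarrow> real" where
  "cell_error w R \<omega> =
     (SUP M\<in>{M \<in> sym_mat. norm M \<le> 1}. SUP x\<in>ball 0 R. \<bar>w M R \<omega> x\<bar>) / R\<^sup>2"

definition A_hat ::
  "(real \<Rightarrow> ('n::finite) mfield \<Rightarrow> real ^ 'n \<Rightarrow> real) \<Rightarrow>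
   ('n \<Rightarrow> 'n \<Rightarrow> real \<Rightarrow> 'n mfield \<Rightarrow> real ^ 'n \<Rightarrow> real) \<Rightarrow> real \<Rightarrow> 'n mfield \<Rightarrow> real ^ 'n ^ 'n" where
  "A_hat T V R \<omega> = (\<chi> i j. V i j R \<omega> 0 / T R \<omega> 0)"

text \<open>
  \<open>\<P>(E) \<le> p\<close>, including that \<open>E\<close> is an event.  The completion is needed because the solutions, hence
  the events built from them, are determined only up to a null set of realizations.
\<close>

definition prob_le :: "'a measure \<Rightarrow> 'a set \<Rightarrow> real \<Rightarrow> bool" where
  "prob_le P E p \<longleftrightarrow> E \<in> sets (completion P) \<and> measure (completion P) E \<le> p"

end

theory Submission
  imports Defs
begin

text \<open>
  By linearity and uniqueness, \<open>w\<^sub>M\<^sub>,\<^sub>R = (\<Sum>\<^sub>i\<^sub>j M\<^sub>i\<^sub>j V\<^sub>i\<^sub>j\<^sub>,\<^sub>R) - (Abar : M) T\<^sub>R\<close>.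
  Evaluating at the origin gives \<open>(A_hat - Abar) : M = w\<^sub>M\<^sub>,\<^sub>R(0) / T\<^sub>R(0)\<close>, and comparison with
  \<open>(R\<^sup>2 - \<bar>x\<bar>\<^sup>2) / (2d)\<close> gives \<open>T\<^sub>R(0) \<ge> R\<^sup>2 / (2d)\<close> because \<open>tr A \<le> d\<close>.  Taking for \<open>M\<close> the
  normalized symmetric matrix \<open>A_hat - Abar\<close> bounds its norm by \<open>2d X\<^sub>R\<close>.  That the exceptional set
  is an event follows from the continuity of the solution at the origin with respect to the
  locally uniform convergence of the coefficients.
\<close>

section \<open>Symmetric matrices, quadratic forms and the trace pairing\<close>

lemma sym_mat_iff: "M \<in> sym_mat \<longleftrightarrow> (\<forall>i j. M $ i $ j = M $ j $ i)"
  by (auto simp: sym_mat_def transpose_def vec_eq_iff)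

lemma inner_mat_eq_sum: "(a :: real ^ 'n ^ 'm) \<bullet> b = (\<Sum>i\<in>UNIV. \<Sum>j\<in>UNIV. a $ i $ j * b $ i $ j)"
  by (simp add: inner_vec_def)

lemma inner_mat_one: "(a :: real ^ 'n ^ 'n) \<bullet> mat 1 = trace a"
  by (simp add: inner_mat_eq_sum mat_def trace_def if_distrib cong: if_cong)

lemma quadratic_form_axis: "axis i 1 \<bullet> ((a :: real ^ 'n ^ 'n) *v axis j 1) = a $ i $ j"
  by (simp add: inner_axis' matrix_vector_mult_basis column_def)

lemma sym_mat_self_adjoint:
  assumes "a \<in> sym_mat"
  shows "x \<bullet> (a *v y) = y \<bullet> (a *v x)"
proof -
  have "x v* a = a *v x"
    using assms transpose_matrix_vector[of a x] by (simp add: sym_mat_def del: transpose_matrix_vector)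
  then show ?thesis
    using dot_lmul_matrix[of x a y] by (simp add: inner_commute)
qed

text \<open>The rank-one matrix \<open>r r^T\<close>; a multiple of it is what a Schur complement
  subtracts.\<close>

definition outer_square :: "real ^ 'n \<Rightarrow> real ^ 'n ^ 'n" where
  "outer_square r = (\<chi> i j. r $ i * r $ j)"

lemma outer_square_mult: "outer_square r *v v = (r \<bullet> v) *\<^sub>R r"
  by (simp add: outer_square_def matrix_vector_mult_def vec_eq_iff inner_vec_def sum_distrib_left
      mult_ac)

lemma outer_square_inner: "outer_square r \<bullet> H = r \<bullet> (H *v r)"
  by (simp add: outer_square_def inner_vec_def matrix_vector_mult_def sum_distrib_left
      mult_ac)

text \<open>Along \<open>t e_k + e_j\<close> the quadratic form is affine in \<open>t\<close> when
  the diagonal entry at \<open>k\<close> vanishes, and a nonzero slope would make it negative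
  somewhere. This settles the case of a zero pivot in the elimination below.\<close>

lemma psd_zero_diagonal:
  assumes a: "a \<in> sym_mat" and psd: "loewner_le 0 a" and k: "a $ k $ k = 0"
  shows "a $ k $ j = 0"
proof (rule ccontr)
  assume nz: "a $ k $ j \<noteq> 0"
  \<comment> \<open>The parameter at which the affine function takes the value -1.\<close>
  define t where "t = - (a $ j $ j + 1) / (2 * a $ k $ j)"
  define v where "v = t *\<^sub>R axis k 1 + axis j (1::real)"
  have "0 \<le> v \<bullet> (a *v v)"
    using psd by (simp add: loewner_le_def)
  also have "v \<bullet> (a *v v) = t * t * a $ k $ k + t * a $ k $ j + t * a $ j $ k + a $ j $ j"
    by (simp add: v_def matrix_vector_right_distrib matrix_vector_mult_scaleR inner_add_left
        inner_add_right quadratic_form_axis algebra_simps)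
  also have "\<dots> = 2 * t * a $ k $ j + a $ j $ j"
    using a k by (simp add: sym_mat_iff)
  also have "\<dots> = -1"
    using nz by (simp add: t_def field_simps)
  finally show False by simp
qed

text \<open>Induction on the support of \<open>a\<close>, removing one index at a time by a Schur complement.\<close>

lemma psd_inner_nonpos:
  fixes a H :: "real ^ 'n ^ 'n"
  assumes "a \<in> sym_mat" "loewner_le 0 a" and H: "\<And>v. v \<bullet> (H *v v) \<le> 0"
  shows "a \<bullet> H \<le> 0"
proof -
  \<comment> \<open>The matrix is quantified inside because the induction step replaces it by its
    Schur complement. Vanishing rows outside \<open>S\<close> stand for the support; for empty
    \<open>S\<close> the matrix is zero.\<close>
  have "\<forall>a. a \<in> sym_mat \<longrightarrow> loewner_le 0 a \<longrightarrow> (\<forall>i j. i \<notin> S \<longrightarrow> a $ i $ j = 0) \<longrightarrow> a \<bullet> H \<le> 0"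
    if "finite S" for S :: "'n set"
    using that
  proof (induction S)
    case empty
    then show ?case by (auto simp: inner_mat_eq_sum)
  next
    case (insert k S)
    show ?case
    proof (intro allI impI)
      fix a :: "real ^ 'n ^ 'n"
      assume a: "a \<in> sym_mat" "loewner_le 0 a" "\<forall>i j. i \<notin> insert k S \<longrightarrow> a $ i $ j = 0"
      show "a \<bullet> H \<le> 0"
      proof (cases "a $ k $ k = 0")
        case True
        \<comment> \<open>With a zero pivot the whole row \<open>k\<close> already vanishes, so the
          induction hypothesis applies to \<open>a\<close> itself.\<close>
        then have "\<forall>i j. i \<notin> S \<longrightarrow> a $ i $ j = 0"
          using a psd_zero_diagonal[OF a(1,2) True] by (metis insert_iff)
        then show ?thesis using insert.IH a by blast
      next
        case False
        define r where "r = a *v axis k 1"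
        have r: "r $ i = a $ i $ k" for i
          by (simp add: r_def matrix_vector_mult_basis column_def)
        have "0 \<le> a $ k $ k"
          using a(2) quadratic_form_axis[of k a k] by (metis inner_zero_right loewner_le_def matrix_vector_mult_0)
        with False have pos: "a $ k $ k > 0" by simp
        \<comment> \<open>Eliminating with the pivot at \<open>k\<close>: the subtracted matrix
          cancels row \<open>k\<close>, and rows outside \<open>insert k S\<close> stay zero because
          \<open>r\<close> vanishes there.\<close>
        define b where "b = a - (1 / a $ k $ k) *\<^sub>R outer_square r"
        have b_mult: "b *v v = a *v v - (r \<bullet> v / a $ k $ k) *\<^sub>R r" for v
          by (simp add: b_def matrix_vector_mult_diff_rdistrib outer_square_mult
              scaleR_matrix_vector_assoc[symmetric])
        have "b \<in> sym_mat"
          using a(1) by (simp add: b_def sym_mat_iff outer_square_def mult.commute)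
        moreover have "loewner_le 0 b"
          unfolding loewner_le_def
        proof
          fix v
          define c where "c = (r \<bullet> v) / a $ k $ k"
          have sa: "axis k 1 \<bullet> (a *v v) = r \<bullet> v"
            unfolding r_def using sym_mat_self_adjoint[OF a(1)] by (simp add: inner_commute)
          have va: "v \<bullet> r = r \<bullet> v" by (rule inner_commute)
          have kk: "axis k 1 \<bullet> r = a $ k $ k"
            by (simp add: r_def quadratic_form_axis)
          \<comment> \<open>Completing the square: \<open>c\<close> minimizes the form of
            \<open>a\<close> along the direction \<open>e_k\<close>, and the minimum is exactly the
            form of \<open>b\<close> at \<open>v\<close>.\<close>
          have "0 \<le> (v - c *\<^sub>R axis k 1) \<bullet> (a *v (v - c *\<^sub>R axis k 1))"
            using a(2) by (simp add: loewner_le_def)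
          also have "\<dots> = (v - c *\<^sub>R axis k 1) \<bullet> (a *v v - c *\<^sub>R r)"
            by (simp add: matrix_vector_mult_diff_distrib matrix_vector_mult_scaleR r_def)
          also have "\<dots> = v \<bullet> (a *v v) - c * (r \<bullet> v) - c * (r \<bullet> v) + c * c * a $ k $ k"
            by (simp add: inner_diff_left inner_diff_right sa kk va algebra_simps)
          also have "\<dots> = v \<bullet> (b *v v)"
            using pos by (simp add: b_mult inner_diff_right va c_def)
          finally show "v \<bullet> (0 *v v) \<le> v \<bullet> (b *v v)" by simp
        qed
        moreover have "b $ i $ j = 0" if "i \<notin> S" for i j
        proof (cases "i = k")
          case True
          then show ?thesis using pos a(1) by (simp add: b_def r sym_mat_iff outer_square_def)
        next
          case False
          then show ?thesis using that a(3) by (simp add: b_def r outer_square_def)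
        qed
        ultimately have "b \<bullet> H \<le> 0" using insert.IH by blast
        \<comment> \<open>The rank-one part contributes a value of the form of \<open>H\<close>
          divided by a positive pivot, hence something nonpositive.\<close>
        moreover have "a \<bullet> H = b \<bullet> H + (r \<bullet> (H *v r)) / a $ k $ k"
          by (simp add: b_def inner_diff_left outer_square_inner)
        moreover have "(r \<bullet> (H *v r)) / a $ k $ k \<le> 0"
          using H pos by (simp add: divide_nonpos_pos)
        ultimately show ?thesis by simp
      qed
    qed
  qed
  from this[of UNIV] assms show ?thesis by simp
qed

section \<open>Calculus of gradients and Hessians\<close>

text \<open>
  The Hessian as the derivative of a gradient field \<open>G\<close>; the side of the matrix product matches the
  index convention of \<open>hessian\<close>, for which the first index is differentiated last.
\<close>

definition has_hessian_on ::
  "(real ^ 'n) set \<Rightarrow> (real ^ 'n \<Rightarrow> real) \<Rightarrow> (real ^ 'n \<Rightarrow> real ^ 'n ^ 'n) \<Rightarrow> bool" where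
  "has_hessian_on U u H \<longleftrightarrow> (\<exists>G. \<forall>x\<in>U. (u has_derivative (\<lambda>h. G x \<bullet> h)) (at x) \<and>
     (G has_derivative (\<lambda>h. h v* H x)) (at x))"

lemma has_hessian_on_add:
  assumes "has_hessian_on U u H" "has_hessian_on U v K"
  shows "has_hessian_on U (\<lambda>x. u x + v x) (\<lambda>x. H x + K x)"
proof -
  obtain G L where
    "\<forall>x\<in>U. (u has_derivative (\<lambda>h. G x \<bullet> h)) (at x) \<and> (G has_derivative (\<lambda>h. h v* H x)) (at x)"
    "\<forall>x\<in>U. (v has_derivative (\<lambda>h. L x \<bullet> h)) (at x) \<and> (L has_derivative (\<lambda>h. h v* K x)) (at x)"
    using assms unfolding has_hessian_on_def by blast
  then show ?thesis
    unfolding has_hessian_on_def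
    by (intro exI[of _ "\<lambda>x. G x + L x"])
      (auto simp: fun_eq_iff inner_add_left vector_matrix_mult_add_rdistrib intro!: derivative_eq_intros)
qed

lemma has_hessian_on_cmult:
  assumes "has_hessian_on U u H"
  shows "has_hessian_on U (\<lambda>x. c * u x) (\<lambda>x. c *\<^sub>R H x)"
proof -
  obtain G where
    G: "\<forall>x\<in>U. (u has_derivative (\<lambda>h. G x \<bullet> h)) (at x) \<and> (G has_derivative (\<lambda>h. h v* H x)) (at x)"
    using assms unfolding has_hessian_on_def by blast
  have "h v* (c *\<^sub>R M) = c *\<^sub>R (h v* M)" for h and M :: "real ^ 'a ^ 'a"
    by (simp add: vector_matrix_mult_def vec_eq_iff sum_distrib_left mult_ac)
  with G show ?thesis
    unfolding has_hessian_on_def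
    by (intro exI[of _ "\<lambda>x. c *\<^sub>R G x"])
      (auto simp: fun_eq_iff intro!: derivative_eq_intros)
qed

lemma has_hessian_on_zero: "has_hessian_on U (\<lambda>_. 0) (\<lambda>_. 0)"
  unfolding has_hessian_on_def
  by (rule exI[of _ "\<lambda>_. 0"])
    (auto simp: fun_eq_iff vector_matrix_mult_def zero_vec_def[symmetric] intro!: derivative_eq_intros)

lemma has_hessian_on_sum:
  assumes "\<And>i. i \<in> I \<Longrightarrow> has_hessian_on U (u i) (H i)"
  shows "has_hessian_on U (\<lambda>x. \<Sum>i\<in>I. u i x) (\<lambda>x. \<Sum>i\<in>I. H i x)"
  using assms
  by (induction I rule: infinite_finite_induct) (auto intro: has_hessian_on_zero has_hessian_on_add)

lemma has_hessian_on_diff: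
  assumes "has_hessian_on U u H" "has_hessian_on U v K"
  shows "has_hessian_on U (\<lambda>x. u x - v x) (\<lambda>x. H x - K x)"
  using has_hessian_on_add[OF assms(1) has_hessian_on_cmult[OF assms(2), of "-1"]] by simp

text \<open>Pairing this Hessian with \<open>a\<close> gives twice the trace of \<open>a\<close>, so
  multiples of \<open>x \<bullet> x\<close> serve below both as strict perturbations and as
  barriers.\<close>

lemma has_hessian_on_norm_square: "has_hessian_on U (\<lambda>x. x \<bullet> x) (\<lambda>_. 2 *\<^sub>R mat 1)"
proof -
  have "h v* (2 *\<^sub>R mat 1) = 2 *\<^sub>R h" for h :: "real ^ 'a"
    by (simp add: vector_matrix_mult_def mat_def vec_eq_iff if_distrib if_distribR cong: if_cong)
  then show ?thesis
    unfolding has_hessian_on_def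
    by (intro exI[of _ "\<lambda>x. 2 *\<^sub>R x"])
      (auto intro!: derivative_eq_intros simp: inner_commute)
qed

lemma has_hessian_on_subset: "has_hessian_on U u H \<Longrightarrow> S \<subseteq> U \<Longrightarrow> has_hessian_on S u H"
  unfolding has_hessian_on_def by blast

lemma differentiable_gradient:
  fixes u :: "real ^ 'n \<Rightarrow> real"
  assumes "u differentiable (at x)"
  shows "(u has_derivative (\<lambda>h. (\<chi> i. partial_deriv i u x) \<bullet> h)) (at x)"
proof -
  let ?D = "frechet_derivative u (at x)"
  have D: "(u has_derivative ?D) (at x)"
    using assms frechet_derivative_works by blast
  then interpret bounded_linear ?D by (rule has_derivative_bounded_linear)
  have "?D = (\<lambda>h. (\<chi> i. partial_deriv i u x) \<bullet> h)"
  proof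
    fix h
    have "?D h = ?D (\<Sum>i\<in>UNIV. h $ i *\<^sub>R axis i 1)"
      using basis_expansion[of h] by (simp add: scalar_mult_eq_scaleR)
    also have "\<dots> = (\<Sum>i\<in>UNIV. h $ i * ?D (axis i 1))"
      by (simp add: sum scaleR)
    finally show "?D h = (\<chi> i. partial_deriv i u x) \<bullet> h"
      by (simp add: inner_vec_def partial_deriv_def mult.commute)
  qed
  with D show ?thesis by simp
qed

text \<open>The first partial derivatives are themselves differentiable, so the gradient field is
  differentiable component by component.\<close>

lemma Ck_on_2_has_hessian:
  assumes "Ck_on 2 U u"
  shows "has_hessian_on U u (hessian u)"
  unfolding has_hessian_on_def
proof (intro exI ballI conjI)
  fix x assume x: "x \<in> U"
  show "(u has_derivative (\<lambda>h. (\<chi> i. partial_deriv i u x) \<bullet> h)) (at x)"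
    using assms x by (intro differentiable_gradient) (simp add: numeral_2_eq_2)
  have "((\<lambda>x. (\<chi> j. partial_deriv j u x) $ j) has_derivative (\<lambda>h. (h v* hessian u x) $ j)) (at x)" for j
  proof -
    have "(partial_deriv j u has_derivative (\<lambda>h. (\<chi> i. partial_deriv i (partial_deriv j u) x) \<bullet> h)) (at x)"
      using assms x by (intro differentiable_gradient) (simp add: numeral_2_eq_2)
    then show ?thesis
      by (simp add: vector_matrix_mult_def hessian_def inner_vec_def mult.commute)
  qed
  then show "((\<lambda>x. \<chi> j. partial_deriv j u x) has_derivative (\<lambda>h. h v* hessian u x)) (at x)"
    by (subst has_derivative_componentwise_within)
      (auto simp: Basis_vec_def cart_eq_inner_axis[symmetric])
qed

lemma continuous_on_hessian:
  assumes "Ck_on 2 U u"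
  shows "continuous_on U (hessian u)"
proof -
  have "continuous_on U (partial_deriv i (partial_deriv j u))" for i j
    using assms by (simp add: numeral_2_eq_2)
  then show ?thesis
    unfolding hessian_def[abs_def] by (intro continuous_on_vec_lambda)
qed

section \<open>Maximum principles and the barrier estimate on a ball\<close>

text \<open>Restricted to the line through \<open>x\<close> in direction \<open>v\<close>,
  \<open>u\<close> has slope zero at the maximum. A positive second derivative would make the slope
  positive just to the right, and the mean value theorem would produce a value above the
  maximum.\<close>

lemma hessian_at_max:
  fixes u :: "real ^ 'n \<Rightarrow> real"
  assumes "has_hessian_on U u H" "open U" "x \<in> U" and max: "\<And>y. y \<in> U \<Longrightarrow> u y \<le> u x"
  shows "v \<bullet> (H x *v v) \<le> 0"
proof (rule ccontr)
  assume "\<not> v \<bullet> (H x *v v) \<le> 0"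
  then have pos: "v \<bullet> (H x *v v) > 0" by simp
  obtain G where
    G: "\<And>x. x \<in> U \<Longrightarrow> (u has_derivative (\<lambda>h. G x \<bullet> h)) (at x)"
       "\<And>x. x \<in> U \<Longrightarrow> (G has_derivative (\<lambda>h. h v* H x)) (at x)"
    using assms(1) unfolding has_hessian_on_def by blast
  define S where "S = (\<lambda>t. x + t *\<^sub>R v) -` U"
  have S: "open S"
    unfolding S_def using \<open>open U\<close> by (intro open_vimage continuous_intros)
  have "0 \<in> S" using \<open>x \<in> U\<close> by (simp add: S_def)
  have g: "((\<lambda>t. u (x + t *\<^sub>R v)) has_real_derivative (G (x + t *\<^sub>R v) \<bullet> v)) (at t)" if "t \<in> S" for t
  proof -
    have "((\<lambda>t. x + t *\<^sub>R v) has_derivative (\<lambda>h. h *\<^sub>R v)) (at t)"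
      by (auto intro!: derivative_eq_intros)
    then have "((\<lambda>t. u (x + t *\<^sub>R v)) has_derivative (\<lambda>h. G (x + t *\<^sub>R v) \<bullet> (h *\<^sub>R v))) (at t)"
      by (rule has_derivative_compose) (use G(1) that in \<open>auto simp: S_def\<close>)
    then show ?thesis
      by (simp add: has_field_derivative_def mult_commute_abs)
  qed
  have g': "((\<lambda>t. G (x + t *\<^sub>R v) \<bullet> v) has_real_derivative v \<bullet> (H x *v v)) (at 0)"
  proof -
    have "((\<lambda>t. x + t *\<^sub>R v) has_derivative (\<lambda>h. h *\<^sub>R v)) (at 0)"
      by (auto intro!: derivative_eq_intros)
    moreover have "(G has_derivative (\<lambda>h. h v* H x)) (at (x + 0 *\<^sub>R v))"
      using G(2) \<open>x \<in> U\<close> by simp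
    ultimately have "((\<lambda>t. G (x + t *\<^sub>R v)) has_derivative (\<lambda>h. (h *\<^sub>R v) v* H x)) (at 0)"
      by (rule has_derivative_compose)
    then have "((\<lambda>t. G (x + t *\<^sub>R v) \<bullet> v) has_derivative (\<lambda>h. ((h *\<^sub>R v) v* H x) \<bullet> v)) (at 0)"
      by (intro has_derivative_inner_left)
    moreover have "((h *\<^sub>R v) v* H x) \<bullet> v = v \<bullet> (H x *v v) * h" for h
      by (simp add: dot_lmul_matrix)
    ultimately show ?thesis
      by (simp add: has_field_derivative_def)
  qed
  obtain d0 where d0: "d0 > 0" "ball 0 d0 \<subseteq> S"
    using S \<open>0 \<in> S\<close> open_contains_ball by blast
  have "G x \<bullet> v = 0"
  proof -
    have "\<forall>y. \<bar>0 - y\<bar> < d0 \<longrightarrow> u (x + y *\<^sub>R v) \<le> u (x + 0 *\<^sub>R v)"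
      using d0 max by (auto simp: S_def subset_iff dist_real_def)
    from DERIV_local_max[OF g[OF \<open>0 \<in> S\<close>] \<open>d0 > 0\<close> this] show ?thesis by simp
  qed
  moreover obtain d1 where d1: "d1 > 0"
    "\<And>t. 0 < t \<Longrightarrow> t < d1 \<Longrightarrow> G (x + 0 *\<^sub>R v) \<bullet> v < G (x + t *\<^sub>R v) \<bullet> v"
    using DERIV_pos_inc_right[OF g' pos] by (metis add_0)
  ultimately have G_pos: "G (x + t *\<^sub>R v) \<bullet> v > 0" if "0 < t" "t < d1" for t
    using that by fastforce
  \<comment> \<open>The segment up to \<open>d\<close> stays in \<open>U\<close> because of
    \<open>d0\<close>, and the slope is positive on its interior because of
    \<open>d1\<close>.\<close>
  define d where "d = min d0 d1 / 2"
  have d: "0 < d" "d < d0" "d < d1" using d0 d1 by (auto simp: d_def)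
  have inS: "t \<in> S" if "0 \<le> t" "t \<le> d" for t
    using that d d0 by (auto simp: subset_iff dist_real_def)
  have "\<exists>z>0. z < d \<and> u (x + d *\<^sub>R v) - u (x + 0 *\<^sub>R v) = (d - 0) * (G (x + z *\<^sub>R v) \<bullet> v)"
    using d(1) g inS by (intro MVT2) auto
  then obtain z where "0 < z" "z < d" "u (x + d *\<^sub>R v) - u x = d * (G (x + z *\<^sub>R v) \<bullet> v)"
    by auto
  moreover from this have "d * (G (x + z *\<^sub>R v) \<bullet> v) > 0"
    using d G_pos by simp
  moreover have "u (x + d *\<^sub>R v) \<le> u x"
    using max inS[of d] d by (simp add: S_def)
  ultimately show False by linarith
qed

text \<open>At an interior maximum the Hessian is negative semidefinite, so its pairing with a
  positive semidefinite \<open>a\<close> cannot be positive. The maximum over the compact closure is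
  therefore attained on the frontier.\<close>

lemma strict_max_principle:
  fixes u :: "real ^ 'n \<Rightarrow> real"
  assumes U: "open U" "bounded U" and u: "continuous_on (closure U) u" "has_hessian_on U u H"
    and a: "\<And>x. x \<in> U \<Longrightarrow> a x \<in> sym_mat" "\<And>x. x \<in> U \<Longrightarrow> loewner_le 0 (a x)"
    and pos: "\<And>x. x \<in> U \<Longrightarrow> a x \<bullet> H x > 0"
    and bdry: "\<And>x. x \<in> frontier U \<Longrightarrow> u x \<le> m" and x: "x \<in> closure U"
  shows "u x \<le> m"
proof -
  have "compact (closure U)" using U by simp
  moreover have "closure U \<noteq> {}" using x by (metis empty_iff)
  ultimately have "\<exists>y\<in>closure U. \<forall>z\<in>closure U. u z \<le> u y"
    using u(1) by (rule continuous_attains_sup)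
  then obtain y where y: "y \<in> closure U" "\<And>z. z \<in> closure U \<Longrightarrow> u z \<le> u y"
    by auto
  have "y \<notin> U"
  proof
    assume "y \<in> U"
    then have "a y \<bullet> H y \<le> 0"
      using a hessian_at_max[OF u(2) U(1)] y(2) closure_subset[of U]
      by (intro psd_inner_nonpos) (auto simp: subset_iff)
    with pos[OF \<open>y \<in> U\<close>] show False by simp
  qed
  then have "y \<in> frontier U"
    using y(1) U(1) by (simp add: frontier_def interior_open)
  with bdry y(2)[OF x] show ?thesis by fastforce
qed

text \<open>Adding \<open>e * (x \<bullet> x)\<close> raises the pairing by \<open>2 * e\<close>
  times the positive trace, which makes it strict; the error on the bounded set is at most
  \<open>e * B\<^sup>2\<close>.\<close>

lemma max_principle:
  fixes u :: "real ^ 'n \<Rightarrow> real"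
  assumes U: "open U" "bounded U" and u: "continuous_on (closure U) u" "has_hessian_on U u H"
    and a: "\<And>x. x \<in> U \<Longrightarrow> a x \<in> sym_mat" "\<And>x. x \<in> U \<Longrightarrow> loewner_le 0 (a x)"
      "\<And>x. x \<in> U \<Longrightarrow> trace (a x) > 0"
    and nonneg: "\<And>x. x \<in> U \<Longrightarrow> a x \<bullet> H x \<ge> 0"
    and bdry: "\<And>x. x \<in> frontier U \<Longrightarrow> u x \<le> m" and x: "x \<in> closure U"
  shows "u x \<le> m"
proof -
  obtain B where B: "\<And>y. y \<in> closure U \<Longrightarrow> norm y \<le> B"
    using U(2) bounded_closure bounded_iff by metis
  have "u x \<le> m + e * B\<^sup>2" if "e > 0" for e
  proof -
    have "u x + e * (x \<bullet> x) \<le> m + e * B\<^sup>2"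
    proof (rule strict_max_principle[OF U _ _ a(1,2) _ _ x])
      show "continuous_on (closure U) (\<lambda>x. u x + e * (x \<bullet> x))"
        by (intro continuous_intros u(1))
      show "has_hessian_on U (\<lambda>x. u x + e * (x \<bullet> x)) (\<lambda>x. H x + e *\<^sub>R 2 *\<^sub>R mat 1)"
        by (intro has_hessian_on_add has_hessian_on_cmult has_hessian_on_norm_square u(2))
      show "a y \<bullet> (H y + e *\<^sub>R 2 *\<^sub>R mat 1) > 0" if "y \<in> U" for y
        using nonneg[OF that] a(3)[OF that] \<open>e > 0\<close>
        by (simp add: inner_add_right inner_mat_one add_nonneg_pos)
      show "u y + e * (y \<bullet> y) \<le> m + e * B\<^sup>2" if "y \<in> frontier U" for y
      proof -
        have "y \<bullet> y \<le> B\<^sup>2"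
          using B[of y] that by (simp add: frontier_def dot_square_norm power_mono)
        then show ?thesis
          using bdry[OF that] \<open>e > 0\<close> by (intro add_mono mult_left_mono) auto
      qed
    qed
    moreover have "0 \<le> e * (x \<bullet> x)" using that by simp
    ultimately show ?thesis by linarith
  qed
  \<comment> \<open>The point \<open>x\<close> and the bound \<open>B\<close> are fixed while
    \<open>e\<close> tends to 0 from the right.\<close>
  then have "eventually (\<lambda>e. u x \<le> m + e * B\<^sup>2) (at_right 0)"
    by (simp add: eventually_at_filter)
  moreover have "((\<lambda>e. m + e * B\<^sup>2) \<longlongrightarrow> m + 0 * B\<^sup>2) (at_right 0)"
    by (intro tendsto_intros)
  ultimately show ?thesis
    using tendsto_lowerbound[of "\<lambda>e. m + e * B\<^sup>2" "m + 0 * B\<^sup>2" "at_right 0" "u x"] by simp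
qed

text \<open>The barrier is \<open>K (r\<^sup>2 - \<bar>x\<bar>\<^sup>2) / (2 \<tau>)\<close>, so only the trace of \<open>a\<close> enters the bound.\<close>

lemma ball_estimate:
  fixes u :: "real ^ 'n \<Rightarrow> real"
  assumes r: "r > 0" and u: "continuous_on (cball 0 r) u" "has_hessian_on (ball 0 r) u H"
    and a: "\<And>x. x \<in> ball 0 r \<Longrightarrow> a x \<in> sym_mat" "\<And>x. x \<in> ball 0 r \<Longrightarrow> loewner_le 0 (a x)"
    and tr: "\<And>x. x \<in> ball 0 r \<Longrightarrow> trace (a x) \<ge> \<tau>" "\<tau> > 0"
    and K: "\<And>x. x \<in> ball 0 r \<Longrightarrow> \<bar>a x \<bullet> H x\<bar> \<le> K" "K \<ge> 0"
    and bdry: "\<And>x. norm x = r \<Longrightarrow> \<bar>u x\<bar> \<le> m" and x: "x \<in> cball 0 r"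
  shows "\<bar>u x\<bar> \<le> m + K * (r\<^sup>2 - (norm x)\<^sup>2) / (2 * \<tau>)"
proof -
  \<comment> \<open>The one-sided bound is isolated so that it can be used for both \<open>u\<close>
    and \<open>-u\<close>.\<close>
  have *: "v x \<le> m + K * (r\<^sup>2 - (norm x)\<^sup>2) / (2 * \<tau>)"
    if v: "continuous_on (cball 0 r) v" "has_hessian_on (ball 0 r) v L"
      "\<And>x. x \<in> ball 0 r \<Longrightarrow> a x \<bullet> L x \<ge> - K" "\<And>x. norm x = r \<Longrightarrow> v x \<le> m" for v L
  proof -
    \<comment> \<open>With \<open>2 * c * \<tau> = K\<close> the added quadratic contributes at
      least \<open>K\<close> to the pairing, which absorbs the lower bound
      \<open>-K\<close>.\<close>
    define c where "c = K / (2 * \<tau>)"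
    have c: "c \<ge> 0" "2 * c * \<tau> = K" using K(2) tr(2) by (auto simp: c_def)
    have "v x + c * (x \<bullet> x) \<le> m + c * r\<^sup>2"
    proof (rule max_principle[of "ball 0 r" _ "\<lambda>x. L x + c *\<^sub>R 2 *\<^sub>R mat 1" a])
      show "continuous_on (closure (ball 0 r)) (\<lambda>x. v x + c * (x \<bullet> x))"
        using r by (auto intro!: continuous_intros v(1))
      show "has_hessian_on (ball 0 r) (\<lambda>x. v x + c * (x \<bullet> x)) (\<lambda>x. L x + c *\<^sub>R 2 *\<^sub>R mat 1)"
        by (intro has_hessian_on_add has_hessian_on_cmult has_hessian_on_norm_square v(2))
      show "0 \<le> a y \<bullet> (L y + c *\<^sub>R 2 *\<^sub>R mat 1)" if "y \<in> ball 0 r" for y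
      proof -
        have "2 * c * \<tau> \<le> 2 * c * trace (a y)"
          using tr(1)[OF that] c(1) by (intro mult_left_mono) auto
        then show ?thesis
          using v(3)[OF that] c by (simp add: inner_add_right inner_mat_one)
      qed
      show "v y + c * (y \<bullet> y) \<le> m + c * r\<^sup>2" if "y \<in> frontier (ball 0 r)" for y
        using that v(4)[of y] r by (simp add: dot_square_norm)
      show "trace (a y) > 0" if "y \<in> ball 0 r" for y
        using tr that by (meson less_le_trans)
    qed (use a x r in auto)
    then show ?thesis by (simp add: c_def dot_square_norm algebra_simps diff_divide_distrib)
  qed
  have "u x \<le> m + K * (r\<^sup>2 - (norm x)\<^sup>2) / (2 * \<tau>)"
    using K(1) bdry by (intro *[OF u]) (auto simp: abs_le_iff minus_le_iff)
  moreover have "-1 * u x \<le> m + K * (r\<^sup>2 - (norm x)\<^sup>2) / (2 * \<tau>)"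
    using K(1) bdry by (intro *[OF _ has_hessian_on_cmult[OF u(2)]]) 
      (auto simp: abs_le_iff intro!: continuous_intros u(1))
  ultimately show ?thesis by (simp add: abs_le_iff)
qed

section \<open>Ellipticity in terms of the trace\<close>

lemma loewner_less_imp_le: "loewner_less 0 a \<Longrightarrow> loewner_le 0 a"
  unfolding loewner_less_def loewner_le_def
  by (metis inner_zero_left less_imp_le order_refl)

lemma loewner_less_imp_trace_pos:
  fixes a :: "real ^ 'n ^ 'n"
  assumes "loewner_less 0 a"
  shows "trace a > 0"
proof -
  have "a $ i $ i > 0" for i
    using assms quadratic_form_axis[of i a i] unfolding loewner_less_def
    by (metis axis_eq_0_iff inner_zero_right matrix_vector_mult_0 zero_neq_one)
  then show ?thesis by (auto simp: trace_def intro: sum_pos)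
qed

text \<open>Diagonal entries are values of the quadratic form at unit vectors, hence at most 1. This
  is the origin of the dimension factor in the final estimate.\<close>

lemma loewner_le_one_imp_trace_le:
  fixes a :: "real ^ 'n ^ 'n"
  assumes "loewner_le a (mat 1)"
  shows "trace a \<le> real CARD('n)"
proof -
  have "a $ i $ i \<le> 1" for i
    using assms quadratic_form_axis[of i a i] unfolding loewner_le_def
    by (metis inner_axis_axis inner_real_def matrix_vector_mul_lid mult_1)
  then have "(\<Sum>i\<in>UNIV. a $ i $ i) \<le> (\<Sum>i\<in>(UNIV :: 'n set). 1)"
    by (intro sum_mono) auto
  then show ?thesis by (simp add: trace_def)
qed

text \<open>Puts a solution into the form used by the maximum principle, with the minus sign moved
  to the right-hand side.\<close>

lemma dirichlet_solution_ballD: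
  assumes "dirichlet_solution a f g (ball 0 R) u" "R > 0"
  shows "continuous_on (cball 0 R) u" "has_hessian_on (ball 0 R) u (hessian u)"
    "\<And>x. x \<in> ball 0 R \<Longrightarrow> a x \<bullet> hessian u x = - f x" "\<And>x. norm x = R \<Longrightarrow> u x = g x"
proof -
  show "continuous_on (cball 0 R) u" "has_hessian_on (ball 0 R) u (hessian u)"
    using assms Ck_on_2_has_hessian by (auto simp: dirichlet_solution_def)
  show "a x \<bullet> hessian u x = - f x" if "x \<in> ball 0 R" for x
  proof -
    have "- (a x \<bullet> hessian u x) = f x"
      using assms that unfolding dirichlet_solution_def by blast
    then show ?thesis by linarith
  qed
  show "u x = g x" if "norm x = R" for x
    using assms that by (auto simp: dirichlet_solution_def)
qed

text \<open>The condition of (H1) for a single realization, which allows the comparison arguments to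
  be deterministic.\<close>

definition elliptic_field :: "('n::finite) mfield \<Rightarrow> bool" where
  "elliptic_field a \<longleftrightarrow> (\<forall>x. a x \<in> sym_mat \<and> loewner_less 0 (a x) \<and> loewner_le (a x) (mat 1))"

lemma elliptic_fieldD:
  assumes "elliptic_field (a :: ('n::finite) mfield)"
  shows "a x \<in> sym_mat" "loewner_le 0 (a x)" "trace (a x) > 0" "trace (a x) \<le> real CARD('n)"
  using assms loewner_less_imp_le loewner_less_imp_trace_pos loewner_le_one_imp_trace_le
  by (auto simp: elliptic_field_def)

section \<open>Uniqueness, the torsion function and linear relations between the solutions\<close>

text \<open>The maximum principle applied to \<open>u\<close> and to \<open>-u\<close>. In this form
  uniqueness turns each linear relation between right-hand sides into one between solutions.\<close>

lemma homogeneous_solution_zero: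
  assumes a: "elliptic_field a" and R: "R > 0"
    and u: "continuous_on (cball 0 R) u" "has_hessian_on (ball 0 R) u H"
    and eq: "\<And>x. x \<in> ball 0 R \<Longrightarrow> a x \<bullet> H x = 0" and bdry: "\<And>x. norm x = R \<Longrightarrow> u x = 0"
    and x: "x \<in> cball 0 R"
  shows "u x = 0"
proof -
  have "u x \<le> 0"
    by (rule max_principle[of "ball 0 R" u H a])
      (use R u eq bdry x in \<open>auto simp: elliptic_fieldD[OF a]\<close>)
  moreover have "-1 * u x \<le> 0"
  proof (rule max_principle[of "ball 0 R" "\<lambda>x. -1 * u x" "\<lambda>x. (-1) *\<^sub>R H x" a])
    show "has_hessian_on (ball 0 R) (\<lambda>x. -1 * u x) (\<lambda>x. (-1) *\<^sub>R H x)"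
      by (rule has_hessian_on_cmult[OF u(2)])
  qed (use R u eq bdry x in \<open>auto simp: elliptic_fieldD[OF a] intro: continuous_on_minus\<close>)
  ultimately show ?thesis by simp
qed

text \<open>With \<open>d = CARD('n)\<close>, the paraboloid
  \<open>(R\<^sup>2 - x \<bullet> x) / (2 * d)\<close> is a subsolution because the trace of
  \<open>a\<close> is at most \<open>d\<close>; comparison with it is read off at the
  origin.\<close>

lemma torsion_lower_bound:
  fixes a :: "('n::finite) mfield"
  assumes a: "elliptic_field a" and R: "R > 0"
    and T: "dirichlet_solution a (\<lambda>_. 1) (\<lambda>_. 0) (ball 0 R) T"
  shows "R\<^sup>2 / (2 * real CARD('n)) \<le> T 0"
proof -
  note T = dirichlet_solution_ballD[OF T R]
  define c where "c = - 1 / (2 * real CARD('n))"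
  let ?u = "\<lambda>x. c * (x \<bullet> x) + -1 * T x" and ?H = "\<lambda>x. c *\<^sub>R 2 *\<^sub>R mat 1 + (-1) *\<^sub>R hessian T x"
  have "?u 0 \<le> c * R\<^sup>2"
  proof (rule max_principle[of "ball 0 R" ?u ?H a])
    show "has_hessian_on (ball 0 R) ?u ?H"
      by (intro has_hessian_on_add has_hessian_on_cmult has_hessian_on_norm_square T(2))
    show "continuous_on (closure (ball 0 R)) ?u"
      using R by (auto intro!: continuous_intros T(1))
    \<comment> \<open>The pairing equals \<open>1 - trace (a x) / d\<close>.\<close>
    show "0 \<le> a x \<bullet> ?H x" if "x \<in> ball 0 R" for x
      using T(3)[OF that] elliptic_fieldD(4)[OF a, of x]
      by (simp add: inner_add_right inner_diff_right inner_mat_one c_def field_simps)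
    show "?u x \<le> c * R\<^sup>2" if "x \<in> frontier (ball 0 R)" for x
      using that R T(4)[of x] by (simp add: dot_square_norm)
  qed (use R in \<open>auto simp: elliptic_fieldD[OF a]\<close>)
  then show ?thesis by (simp add: c_def)
qed

text \<open>Since \<open>a : M\<close> is the sum of \<open>M_ij a_ij\<close>, both sides solve the
  same problem with zero boundary values.\<close>

lemma cell_solution_eq:
  fixes a :: "('n::finite) mfield"
  assumes a: "elliptic_field a" and R: "R > 0"
    and w: "dirichlet_solution a (\<lambda>x. (a x - B) \<bullet> M) (\<lambda>_. 0) (ball 0 R) w"
    and T: "dirichlet_solution a (\<lambda>_. 1) (\<lambda>_. 0) (ball 0 R) T"
    and V: "\<And>i j. dirichlet_solution a (\<lambda>x. a x $ i $ j) (\<lambda>_. 0) (ball 0 R) (V i j)"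
    and x: "x \<in> cball 0 R"
  shows "w x = (\<Sum>i\<in>UNIV. \<Sum>j\<in>UNIV. M $ i $ j * V i j x) - (B \<bullet> M) * T x"
proof -
  note w = dirichlet_solution_ballD[OF w R]
  note T = dirichlet_solution_ballD[OF T R]
  note V = dirichlet_solution_ballD[OF V R]
  let ?u = "\<lambda>x. w x + (B \<bullet> M) * T x - (\<Sum>i\<in>UNIV. \<Sum>j\<in>UNIV. M $ i $ j * V i j x)"
  let ?H = "\<lambda>x. hessian w x + (B \<bullet> M) *\<^sub>R hessian T x -
    (\<Sum>i\<in>UNIV. \<Sum>j\<in>UNIV. M $ i $ j *\<^sub>R hessian (V i j) x)"
  have "?u x = 0"
  proof (rule homogeneous_solution_zero[OF a R _ _ _ _ x])
    show "continuous_on (cball 0 R) ?u"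
      by (intro continuous_intros w T V)
    show "has_hessian_on (ball 0 R) ?u ?H"
      by (intro has_hessian_on_diff has_hessian_on_add has_hessian_on_sum has_hessian_on_cmult w T V)
    show "a x \<bullet> ?H x = 0" if "x \<in> ball 0 R" for x
      using w(3)[OF that] T(3)[OF that] V(3)[OF that]
      by (simp add: inner_add_right inner_diff_right inner_sum_right inner_diff_left sum_negf
          inner_mat_eq_sum[of "a x" M] mult.commute)
    show "?u x = 0" if "norm x = R" for x
      using w(4)[OF that] T(4)[OF that] V(4)[OF that] by simp
  qed
  then show ?thesis by simp
qed

text \<open>Symmetry of \<open>a\<close> gives both functions the same right-hand side. It makes
  \<open>A_hat\<close> symmetric, so that its error is an admissible direction in
  \<open>cell_error\<close>, whose supremum runs over symmetric matrices.\<close>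

lemma entry_solution_symmetric:
  fixes a :: "('n::finite) mfield"
  assumes a: "elliptic_field a" and R: "R > 0"
    and V: "\<And>i j. dirichlet_solution a (\<lambda>x. a x $ i $ j) (\<lambda>_. 0) (ball 0 R) (V i j)"
    and x: "x \<in> cball 0 R"
  shows "V i j x = V j i x"
proof -
  note V = dirichlet_solution_ballD[OF V R]
  have "V i j x - V j i x = 0"
  proof (rule homogeneous_solution_zero[OF a R _ _ _ _ x])
    show "has_hessian_on (ball 0 R) (\<lambda>x. V i j x - V j i x) (\<lambda>x. hessian (V i j) x - hessian (V j i) x)"
      by (intro has_hessian_on_diff V)
    show "a x \<bullet> (hessian (V i j) x - hessian (V j i) x) = 0" if "x \<in> ball 0 R" for x
      using V(3)[OF that] elliptic_fieldD(1)[OF a, of x] by (simp add: inner_diff_right sym_mat_iff)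
  qed (auto intro!: continuous_intros simp: V)
  then show ?thesis by simp
qed

section \<open>Deterministic bound of the matrix error by the cell error\<close>

text \<open>A real \<open>SUP\<close> is an upper bound only of a set that is bounded above; one
  bound \<open>B\<close>, uniform in \<open>M\<close> and \<open>x\<close>, secures this for both
  nested suprema.\<close>

lemma abs_le_cell_error:
  assumes bdd: "\<And>M x. M \<in> sym_mat \<Longrightarrow> norm M \<le> 1 \<Longrightarrow> x \<in> ball 0 R \<Longrightarrow> \<bar>w M R \<omega> x\<bar> \<le> B"
    and M: "M \<in> sym_mat" "norm M \<le> 1" and x: "x \<in> ball 0 R"
  shows "\<bar>w M R \<omega> x\<bar> \<le> R\<^sup>2 * cell_error w R \<omega>"
proof -
  let ?S = "\<lambda>M. SUP x\<in>ball 0 R. \<bar>w M R \<omega> x\<bar>"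
  have R: "R > 0" using x by (simp add: le_less_trans[OF norm_ge_zero])
  have "\<bar>w M R \<omega> x\<bar> \<le> ?S M"
    using bdd M x by (intro cSUP_upper) (auto intro!: bdd_aboveI2)
  also have "?S M \<le> (SUP M\<in>{M \<in> sym_mat. norm M \<le> 1}. ?S M)"
  proof (rule cSUP_upper)
    show "bdd_above (?S ` {M \<in> sym_mat. norm M \<le> 1})"
      using bdd R by (intro bdd_aboveI2[of _ _ B] cSUP_least) auto
  qed (use M in auto)
  also have "\<dots> = R\<^sup>2 * cell_error w R \<omega>"
    using R by (simp add: cell_error_def)
  finally show ?thesis .
qed

text \<open>At the origin \<open>D : M = w_M(0) / T(0)\<close>, where \<open>D\<close> is the error.
  Its own direction as \<open>M\<close> turns the left side into the norm of \<open>D\<close>, and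
  the lower bound on \<open>T(0)\<close> cancels the factor \<open>R\<^sup>2\<close>.\<close>

lemma norm_A_hat_diff_le:
  fixes \<omega> :: "('n::finite) mfield"
  assumes a: "elliptic_field \<omega>" and R: "R > 0" and Abar: "Abar \<in> sym_mat"
    and w: "\<And>M. M \<in> sym_mat \<Longrightarrow>
      dirichlet_solution \<omega> (\<lambda>x. (\<omega> x - Abar) \<bullet> M) (\<lambda>_. 0) (ball 0 R) (w M R \<omega>)"
    and T: "dirichlet_solution \<omega> (\<lambda>_. 1) (\<lambda>_. 0) (ball 0 R) (T R \<omega>)"
    and V: "\<And>i j. dirichlet_solution \<omega> (\<lambda>x. \<omega> x $ i $ j) (\<lambda>_. 0) (ball 0 R) (V i j R \<omega>)"
  shows "norm (A_hat T V R \<omega> - Abar) \<le> 2 * real CARD('n) * cell_error w R \<omega>"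
proof -
  define D where "D = A_hat T V R \<omega> - Abar"
  note w_eq = cell_solution_eq[OF a R w T V]
  have T_lower: "R\<^sup>2 / (2 * real CARD('n)) \<le> T R \<omega> 0"
    using a R T by (rule torsion_lower_bound)
  moreover have "R\<^sup>2 / (2 * real CARD('n)) > 0" using R by simp
  ultimately have T_pos: "T R \<omega> 0 > 0" by linarith
  have "D \<in> sym_mat"
    using Abar entry_solution_symmetric[OF a R V, of 0] R by (auto simp: D_def sym_mat_iff A_hat_def)
  \<comment> \<open>\<open>sgn D\<close> is the normalized error and is 0 when \<open>D = 0\<close>,
    so both cases give an admissible direction.\<close>
  then have M: "sgn D \<in> sym_mat" "norm (sgn D) \<le> 1"
    by (simp add: sgn_div_norm sym_mat_iff, simp add: norm_sgn)
  have sup_bound: "\<exists>B. \<forall>x\<in>ball 0 R. \<bar>u x\<bar> \<le> B"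
    if "dirichlet_solution \<omega> f g (ball 0 R) u" for f g u
  proof -
    have "bounded (u ` cball 0 R)"
      by (rule compact_imp_bounded[OF compact_continuous_image[OF _ compact_cball]])
        (rule dirichlet_solution_ballD(1)[OF that R])
    then obtain B where "\<forall>y\<in>u ` cball 0 R. norm y \<le> B"
      unfolding bounded_iff by (rule exE)
    then show ?thesis by (intro exI[of _ B]) simp
  qed
  obtain BT where BT: "\<forall>x\<in>ball 0 R. \<bar>T R \<omega> x\<bar> \<le> BT"
    using sup_bound[OF T] by (rule exE)
  have "\<forall>i j. \<exists>B. \<forall>x\<in>ball 0 R. \<bar>V i j R \<omega> x\<bar> \<le> B"
    by (intro allI sup_bound[OF V])
  then obtain BV where "\<forall>i j. \<forall>x\<in>ball 0 R. \<bar>V i j R \<omega> x\<bar> \<le> BV i j"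
    unfolding choice_iff by (elim exE)
  then have BV: "\<bar>V i j R \<omega> x\<bar> \<le> BV i j" if "x \<in> ball 0 R" for i j x
    using that by simp
  \<comment> \<open>Boundedness uniform in \<open>M\<close> comes from the linear representation of
    \<open>w\<close>: the entries of \<open>M\<close> are at most 1 in absolute value and only
    finitely many functions occur.\<close>
  have bdd: "\<bar>w M R \<omega> x\<bar> \<le> (\<Sum>i\<in>UNIV. \<Sum>j\<in>UNIV. BV i j) + norm Abar * BT"
    if "M \<in> sym_mat" "norm M \<le> 1" "x \<in> ball 0 R" for M x
  proof -
    have "\<bar>M $ i $ j\<bar> \<le> 1" for i j
      using that(2) component_le_norm_cart[of "M $ i" j] Finite_Cartesian_Product.norm_nth_le[of M i] by linarith
    then have "\<bar>M $ i $ j * V i j R \<omega> x\<bar> \<le> BV i j" for i j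
      using mult_mono[of "\<bar>M $ i $ j\<bar>" 1 "\<bar>V i j R \<omega> x\<bar>" "BV i j"] BV[OF that(3)]
      by (simp add: abs_mult)
    then have "\<bar>\<Sum>i\<in>UNIV. \<Sum>j\<in>UNIV. M $ i $ j * V i j R \<omega> x\<bar> \<le> (\<Sum>i\<in>UNIV. \<Sum>j\<in>UNIV. BV i j)"
      by (intro order_trans[OF sum_abs] sum_mono)
    moreover have "\<bar>(Abar \<bullet> M) * T R \<omega> x\<bar> \<le> norm Abar * BT"
    proof -
      have "\<bar>Abar \<bullet> M\<bar> \<le> norm Abar * norm M" by (rule Cauchy_Schwarz_ineq2)
      also have "\<dots> \<le> norm Abar" using that(2) by (simp add: mult_left_le)
      finally have "\<bar>Abar \<bullet> M\<bar> * \<bar>T R \<omega> x\<bar> \<le> norm Abar * BT"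
        using bspec[OF BT that(3)] by (rule mult_mono) simp_all
      then show ?thesis by (simp add: abs_mult)
    qed
    moreover have "x \<in> cball 0 R" using that(3) by simp
    note w_eq[OF that(1) this]
    ultimately show ?thesis by linarith
  qed
  have "norm D = D \<bullet> sgn D"
    by (cases "D = 0") (simp_all add: sgn_div_norm dot_square_norm power2_eq_square)
  also have "\<dots> = w (sgn D) R \<omega> 0 / T R \<omega> 0"
  proof -
    have "A_hat T V R \<omega> \<bullet> M = (\<Sum>i\<in>UNIV. \<Sum>j\<in>UNIV. M $ i $ j * V i j R \<omega> 0) / T R \<omega> 0" for M
      by (simp add: inner_mat_eq_sum A_hat_def sum_divide_distrib mult.commute)
    moreover have "D \<bullet> sgn D = A_hat T V R \<omega> \<bullet> sgn D - Abar \<bullet> sgn D"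
      by (simp add: D_def inner_diff_left)
    ultimately show ?thesis
      using w_eq[OF M(1), of 0] R T_pos by (simp add: diff_divide_distrib)
  qed
  also have "\<dots> \<le> R\<^sup>2 * cell_error w R \<omega> / (R\<^sup>2 / (2 * real CARD('n)))"
  proof (rule frac_le)
    have "\<bar>w (sgn D) R \<omega> 0\<bar> \<le> R\<^sup>2 * cell_error w R \<omega>"
      using R by (intro abs_le_cell_error[where w = w and \<omega> = \<omega>, OF bdd M]) simp_all
    then show "w (sgn D) R \<omega> 0 \<le> R\<^sup>2 * cell_error w R \<omega>" "0 \<le> R\<^sup>2 * cell_error w R \<omega>"
      by linarith+
  qed (use R T_lower in simp_all)
  also have "\<dots> = 2 * real CARD('n) * cell_error w R \<omega>"
    using R by (simp add: field_simps)
  finally show ?thesis by (simp add: D_def)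
qed

section \<open>Stability of the solution at the origin under perturbation of the
  coefficients\<close>

text \<open>
  On a slightly smaller ball the Hessian of the fixed solution \<open>u\<^sub>0\<close> is bounded, and in the remaining
  thin shell both solutions are small by the barrier of \<open>ball_estimate\<close>.
\<close>

lemma dirichlet_solution_stable:
  fixes a\<^sub>0 :: "('n::finite) mfield"
  assumes R: "R > 0" and e: "e > 0"
    and a\<^sub>0: "continuous_on UNIV a\<^sub>0" "elliptic_field a\<^sub>0"
    and f\<^sub>0: "\<And>x. x \<in> cball 0 R \<Longrightarrow> \<bar>f\<^sub>0 x\<bar> \<le> F"
    and u\<^sub>0: "dirichlet_solution a\<^sub>0 f\<^sub>0 (\<lambda>_. 0) (ball 0 R) u\<^sub>0"
  obtains \<delta> where "\<delta> > 0"
    "\<And>a f u. elliptic_field a \<Longrightarrow> dirichlet_solution a f (\<lambda>_. 0) (ball 0 R) u \<Longrightarrow>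
      (\<And>x. x \<in> cball 0 R \<Longrightarrow> dist (a x) (a\<^sub>0 x) < \<delta>) \<Longrightarrow>
      (\<And>x. x \<in> cball 0 R \<Longrightarrow> \<bar>f x - f\<^sub>0 x\<bar> \<le> \<delta>) \<Longrightarrow> \<bar>u 0 - u\<^sub>0 0\<bar> < e"
proof -
  note U0 = dirichlet_solution_ballD[OF u\<^sub>0 R]
  have "0 \<le> F" using f\<^sub>0[of 0] R by force
  define N where "N = norm (mat 1 :: real ^ 'n ^ 'n)"
  have trace_diff: "\<bar>trace M - trace M'\<bar> \<le> dist M M' * N" for M M' :: "real ^ 'n ^ 'n"
    using Cauchy_Schwarz_ineq2[of "M - M'" "mat 1"]
    by (simp add: inner_mat_one[symmetric] inner_diff_left N_def dist_norm)
  have "\<exists>y\<in>cball 0 R. \<forall>x\<in>cball 0 R. trace (a\<^sub>0 y) \<le> trace (a\<^sub>0 x)"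
    using R by (intro continuous_attains_inf)
      (auto simp: inner_mat_one[symmetric] intro!: continuous_intros continuous_on_subset[OF a\<^sub>0(1)])
  then obtain y where y: "\<And>x. x \<in> cball 0 R \<Longrightarrow> trace (a\<^sub>0 y) \<le> trace (a\<^sub>0 x)"
    by blast
  \<comment> \<open>Half the minimum of the trace of the fixed field; the other half is the room
    left for perturbing the coefficients.\<close>
  define \<tau> where "\<tau> = trace (a\<^sub>0 y) / 2"
  have \<tau>: "\<tau> > 0" using elliptic_fieldD(3)[OF a\<^sub>0(2)] by (simp add: \<tau>_def)
  have tr0: "trace (a\<^sub>0 x) \<ge> 2 * \<tau>" if "x \<in> cball 0 R" for x
    using y[OF that] by (simp add: \<tau>_def)
  \<comment> \<open>\<open>\<eta>\<close> becomes \<open>R\<^sup>2 - r\<^sup>2\<close>. The first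
    entry keeps \<open>r\<close> positive; the second makes the barrier at radius \<open>r\<close>
    at most \<open>e / 8\<close> for data bounded by \<open>F + 1\<close>.\<close>
  define \<eta> where "\<eta> = min (R\<^sup>2 / 2) (e * \<tau> / 4 / (F + 1))"
  have \<eta>: "0 < \<eta>" "\<eta> < R\<^sup>2" "(F + 1) * \<eta> / (2 * \<tau>) \<le> e / 8"
  proof -
    show "0 < \<eta>" using R e \<tau> \<open>0 \<le> F\<close> by (simp add: \<eta>_def)
    show "\<eta> < R\<^sup>2" using zero_less_power[OF R, of 2] by (simp add: \<eta>_def min_less_iff_disj)
    have "\<eta> \<le> e * \<tau> / 4 / (F + 1)" "0 < F + 1"
      using \<open>0 \<le> F\<close> by (auto simp: \<eta>_def)
    then have "\<eta> * (F + 1) \<le> e * \<tau> / 4"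
      by (simp only: pos_le_divide_eq)
    then show "(F + 1) * \<eta> / (2 * \<tau>) \<le> e / 8"
      using \<tau> by (simp add: field_simps)
  qed
  define r where "r = sqrt (R\<^sup>2 - \<eta>)"
  have r2: "r\<^sup>2 = R\<^sup>2 - \<eta>" using \<eta> by (simp add: r_def)
  have r: "0 < r" "r < R"
  proof -
    show "0 < r" using \<eta>(2) by (simp add: r_def)
    show "r < R" using \<eta>(1) r2 R by (intro power_less_imp_less_base[of r 2 R]) simp_all
  qed
  have sub: "cball 0 r \<subseteq> ball (0 :: real ^ 'n) R" using r by auto
  \<comment> \<open>The Hessian is known to be continuous only inside the open ball, so its bound is
    taken on a smaller closed ball.\<close>
  have "bounded (hessian u\<^sub>0 ` cball 0 r)"
  proof (rule compact_imp_bounded[OF compact_continuous_image[OF _ compact_cball]])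
    show "continuous_on (cball 0 r) (hessian u\<^sub>0)"
      by (rule continuous_on_subset[OF continuous_on_hessian sub])
        (use u\<^sub>0 in \<open>simp add: dirichlet_solution_def\<close>)
  qed
  then obtain B where "\<forall>M\<in>hessian u\<^sub>0 ` cball 0 r. norm M \<le> B"
    unfolding bounded_iff by (rule exE)
  then have B: "norm (hessian u\<^sub>0 x) \<le> B" if "x \<in> cball 0 r" for x
    using that by simp
  have "0 \<le> B" using order_trans[OF norm_ge_zero B[of 0]] r by simp
  \<comment> \<open>The three entries keep \<open>f\<close> below \<open>F + 1\<close>, keep the
    trace of \<open>a\<close> above \<open>\<tau>\<close>, and make the interior error at most
    \<open>e / 4\<close>.\<close>
  define \<delta> where "\<delta> = min 1 (min (\<tau> / (N + 1)) (e * \<tau> / 2 / ((1 + B) * R\<^sup>2)))"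
  have "0 \<le> N" by (simp add: N_def)
  have \<delta>: "\<delta> > 0" "\<delta> \<le> 1" "\<delta> * N \<le> \<tau>" "\<delta> * (1 + B) * R\<^sup>2 / (2 * \<tau>) \<le> e / 4"
  proof -
    show "\<delta> > 0" using e \<tau> R \<open>0 \<le> B\<close> \<open>0 \<le> N\<close> by (simp add: \<delta>_def)
    show "\<delta> \<le> 1" by (simp add: \<delta>_def)
    have "\<delta> * N \<le> \<delta> * (N + 1)" using \<open>\<delta> > 0\<close> by simp
    also have "\<dots> \<le> \<tau> / (N + 1) * (N + 1)"
      using \<open>0 \<le> N\<close> by (intro mult_right_mono) (auto simp: \<delta>_def)
    also have "\<dots> = \<tau>" using \<open>0 \<le> N\<close> by simp
    finally show "\<delta> * N \<le> \<tau>" .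
    have "\<delta> \<le> e * \<tau> / 2 / ((1 + B) * R\<^sup>2)" "0 < (1 + B) * R\<^sup>2"
      using \<open>0 \<le> B\<close> R by (auto simp: \<delta>_def)
    then have "\<delta> * ((1 + B) * R\<^sup>2) \<le> e * \<tau> / 2"
      by (simp only: pos_le_divide_eq)
    then show "\<delta> * (1 + B) * R\<^sup>2 / (2 * \<tau>) \<le> e / 4"
      using \<tau> by (simp add: field_simps)
  qed
  show thesis
  proof (rule that[OF \<delta>(1)])
    fix a f u
    assume a: "elliptic_field a" and u: "dirichlet_solution a f (\<lambda>_. 0) (ball 0 R) u"
      and dist: "\<And>x. x \<in> cball 0 R \<Longrightarrow> dist (a x) (a\<^sub>0 x) < \<delta>"
      and f: "\<And>x. x \<in> cball 0 R \<Longrightarrow> \<bar>f x - f\<^sub>0 x\<bar> \<le> \<delta>"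
    note U = dirichlet_solution_ballD[OF u R]
    have tr: "trace (a x) \<ge> \<tau>" if "x \<in> cball 0 R" for x
    proof -
      have "dist (a x) (a\<^sub>0 x) * N \<le> \<delta> * N"
        using dist[OF that] \<open>0 \<le> N\<close> by (intro mult_right_mono) auto
      then show ?thesis using trace_diff[of "a x" "a\<^sub>0 x"] tr0[OF that] \<delta>(3) by linarith
    qed
    have shell: "\<bar>v x\<bar> \<le> e / 8"
      if v: "dirichlet_solution b g (\<lambda>_. 0) (ball 0 R) v" and b: "elliptic_field b"
        and trb: "\<And>x. x \<in> cball 0 R \<Longrightarrow> trace (b x) \<ge> \<tau>"
        and g: "\<And>x. x \<in> cball 0 R \<Longrightarrow> \<bar>g x\<bar> \<le> F + 1" and x: "norm x = r" for b g v and x :: "real ^ 'n"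
    proof -
      note V = dirichlet_solution_ballD[OF v R]
      have "\<bar>v x\<bar> \<le> 0 + (F + 1) * (R\<^sup>2 - (norm x)\<^sup>2) / (2 * \<tau>)"
      proof (rule ball_estimate[OF R V(1,2) elliptic_fieldD(1,2)[OF b] _ \<tau>])
        show "\<tau> \<le> trace (b y)" if "y \<in> ball 0 R" for y
          using that by (intro trb) simp
        show "\<bar>b y \<bullet> hessian v y\<bar> \<le> F + 1" if "y \<in> ball 0 R" for y
          using g[of y] that by (simp add: V(3))
        show "\<bar>v y\<bar> \<le> 0" if "norm y = R" for y
          using V(4)[OF that] by simp
      qed (use \<open>0 \<le> F\<close> x r in simp_all)
      also have "R\<^sup>2 - (norm x)\<^sup>2 = \<eta>" using x r2 by simp
      also have "0 + (F + 1) * \<eta> / (2 * \<tau>) \<le> e / 8" using \<eta>(3) by (simp only: add_0)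
      finally show ?thesis .
    qed
    \<comment> \<open>The comparison on the smaller ball: the boundary term \<open>e / 4\<close> is
      the sum of two shell bounds \<open>e / 8\<close>.\<close>
    have "\<bar>u 0 - u\<^sub>0 0\<bar> \<le> e / 4 + (\<delta> * (1 + B)) * (r\<^sup>2 - (norm (0 :: real ^ 'n))\<^sup>2) / (2 * \<tau>)"
    proof (rule ball_estimate[of r "\<lambda>x. u x - u\<^sub>0 x" "\<lambda>x. hessian u x - hessian u\<^sub>0 x" a])
      show "continuous_on (cball 0 r) (\<lambda>x. u x - u\<^sub>0 x)"
        using r by (intro continuous_on_diff continuous_on_subset[OF U(1)] continuous_on_subset[OF U0(1)]) auto
      show "has_hessian_on (ball 0 r) (\<lambda>x. u x - u\<^sub>0 x) (\<lambda>x. hessian u x - hessian u\<^sub>0 x)"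
        using r by (intro has_hessian_on_diff has_hessian_on_subset[OF U(2)] has_hessian_on_subset[OF U0(2)]) auto
      show "\<bar>a x \<bullet> (hessian u x - hessian u\<^sub>0 x)\<bar> \<le> \<delta> * (1 + B)" if "x \<in> ball 0 r" for x
      proof -
        have x: "x \<in> ball 0 R" "x \<in> cball 0 R" "x \<in> cball 0 r" using that r by auto
        \<comment> \<open>Pairing the difference with the perturbed \<open>a\<close> leaves only the
          Hessian of the fixed solution to be bounded.\<close>
        have "a x \<bullet> (hessian u x - hessian u\<^sub>0 x) = - (f x - f\<^sub>0 x) - (a x - a\<^sub>0 x) \<bullet> hessian u\<^sub>0 x"
          using U(3)[OF x(1)] U0(3)[OF x(1)] by (simp add: inner_diff_left inner_diff_right)
        moreover have "\<bar>(a x - a\<^sub>0 x) \<bullet> hessian u\<^sub>0 x\<bar> \<le> \<delta> * B"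
        proof -
          have "\<bar>(a x - a\<^sub>0 x) \<bullet> hessian u\<^sub>0 x\<bar> \<le> norm (a x - a\<^sub>0 x) * norm (hessian u\<^sub>0 x)"
            by (rule Cauchy_Schwarz_ineq2)
          also have "\<dots> \<le> \<delta> * B"
            using dist[OF x(2)] B[OF x(3)] \<delta>(1) by (intro mult_mono) (auto simp: dist_norm)
          finally show ?thesis .
        qed
        ultimately show ?thesis using f[OF x(2)] by (simp add: distrib_left)
      qed
      show "\<bar>u x - u\<^sub>0 x\<bar> \<le> e / 4" if "norm x = r" for x
      proof -
        have "\<bar>f y\<bar> \<le> F + 1" "\<bar>f\<^sub>0 y\<bar> \<le> F + 1" "\<tau> \<le> trace (a\<^sub>0 y)" if "y \<in> cball 0 R" for y
          using f[OF that] f\<^sub>0[OF that] \<delta>(2) tr0[OF that] \<tau> by linarith+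
        then have "\<bar>u x\<bar> \<le> e / 8" "\<bar>u\<^sub>0 x\<bar> \<le> e / 8"
          using shell[OF u a tr _ that] shell[OF u\<^sub>0 a\<^sub>0(2) _ _ that] by blast+
        then show ?thesis by linarith
      qed
      show "trace (a x) \<ge> \<tau>" if "x \<in> ball 0 r" for x using that r by (intro tr) auto
    qed (use r \<tau> \<delta>(1) \<open>0 \<le> B\<close> elliptic_fieldD[OF a] in auto)
    moreover have "(\<delta> * (1 + B)) * (r\<^sup>2 - (norm (0 :: real ^ 'n))\<^sup>2) / (2 * \<tau>) \<le> \<delta> * (1 + B) * R\<^sup>2 / (2 * \<tau>)"
      using \<tau> \<delta>(1) \<open>0 \<le> B\<close> r2 \<eta>(1) by (intro divide_right_mono mult_left_mono) auto
    ultimately show "\<bar>u 0 - u\<^sub>0 0\<bar> < e" using \<delta>(4) e by linarith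
  qed
qed

section \<open>Measurability with respect to the completed law\<close>

text \<open>Relative to the realizations satisfying \<open>Q\<close>, each superlevel set of
  \<open>g\<close> is the trace of an open set. Open sets are events, and the realizations violating
  \<open>Q\<close> are absorbed by the completion.\<close>

lemma canonical_law_measurable_of_continuous:
  fixes P :: "('n::finite) mfield measure" and g :: "'n mfield \<Rightarrow> real"
  assumes P: "canonical_law P" and AE: "AE \<omega> in P. Q \<omega>" and K: "compact K"
    and cont: "\<And>\<omega>\<^sub>0 e. continuous_on UNIV \<omega>\<^sub>0 \<Longrightarrow> Q \<omega>\<^sub>0 \<Longrightarrow> e > 0 \<Longrightarrow>
      \<exists>\<delta>>0. \<forall>\<omega>. Q \<omega> \<longrightarrow> (\<forall>x\<in>K. dist (\<omega> x) (\<omega>\<^sub>0 x) < \<delta>) \<longrightarrow> \<bar>g \<omega> - g \<omega>\<^sub>0\<bar> < e"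
  shows "g \<in> borel_measurable (completion P)"
  unfolding borel_measurable_iff_greater
proof
  fix a
  \<comment> \<open>The union of this family is the largest open set on whose
    \<open>Q\<close>-realizations \<open>g\<close> exceeds \<open>a\<close>.\<close>
  define \<O> where "\<O> = {N. openin locally_uniform_topology N \<and> (\<forall>\<omega>\<in>N. Q \<omega> \<longrightarrow> a < g \<omega>)}"
  have "openin locally_uniform_topology (\<Union>\<O>)"
    by (rule openin_Union) (simp add: \<O>_def)
  then have "\<Union>\<O> \<in> sets P"
    using P unfolding canonical_law_def by (auto intro: sigma_sets.Basic)
  then have meas: "\<Union>\<O> \<in> sets (completion P)" by simp
  have iff: "\<omega>\<^sub>0 \<in> \<Union>\<O> \<longleftrightarrow> a < g \<omega>\<^sub>0" if Q: "Q \<omega>\<^sub>0" and "\<omega>\<^sub>0 \<in> space P" for \<omega>\<^sub>0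
  proof
    assume "\<omega>\<^sub>0 \<in> \<Union>\<O>"
    then show "a < g \<omega>\<^sub>0" using Q by (auto simp: \<O>_def)
  next
    assume less: "a < g \<omega>\<^sub>0"
    have c: "continuous_on UNIV \<omega>\<^sub>0"
      using that P by (auto simp: canonical_law_def)
    obtain \<delta> where \<delta>: "\<delta> > 0"
      "\<forall>\<omega>. Q \<omega> \<longrightarrow> (\<forall>x\<in>K. dist (\<omega> x) (\<omega>\<^sub>0 x) < \<delta>) \<longrightarrow> \<bar>g \<omega> - g \<omega>\<^sub>0\<bar> < g \<omega>\<^sub>0 - a"
      using cont[OF c Q, of "g \<omega>\<^sub>0 - a"] less by auto
    \<comment> \<open>A generating neighbourhood of the locally uniform topology, centred at the
      given realization.\<close>
    define N where "N = {h. continuous_on UNIV h \<and> (\<forall>x\<in>K. dist (h x) (\<omega>\<^sub>0 x) < \<delta>)}"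
    have "openin locally_uniform_topology N"
      unfolding locally_uniform_topology_def N_def
      by (rule topology_generated_by_Basis) (use c K \<delta>(1) in blast)
    moreover have "a < g \<omega>" if "\<omega> \<in> N" "Q \<omega>" for \<omega>
    proof -
      have "\<bar>g \<omega> - g \<omega>\<^sub>0\<bar> < g \<omega>\<^sub>0 - a" using \<delta>(2) that by (simp add: N_def)
      then show ?thesis by linarith
    qed
    ultimately have "N \<in> \<O>" by (simp add: \<O>_def)
    moreover have "\<omega>\<^sub>0 \<in> N" using c \<delta>(1) by (simp add: N_def)
    ultimately show "\<omega>\<^sub>0 \<in> \<Union>\<O>" by (rule UnionI)
  qed
  have "AE \<omega> in completion P. \<omega> \<in> \<Union>\<O> \<longleftrightarrow> \<omega> \<in> {\<omega> \<in> space (completion P). a < g \<omega>}"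
    using AE_completion[OF AE] AE_space by eventually_elim (simp add: iff del: Union_iff)
  then show "{\<omega> \<in> space (completion P). a < g \<omega>} \<in> sets (completion P)"
    by (rule completion.in_sets_AE[OF _ meas]) simp
qed

text \<open>Where \<open>u\<close> is a solution, stability makes its value at the origin continuous
  in the coefficients. The function \<open>\<phi>\<close> covers the constant and the entry
  right-hand sides together; Lipschitz constant 1 lets one \<open>\<delta>\<close> control both
  coefficients and data.\<close>

lemma dirichlet_solution_measurable:
  fixes P :: "('n::finite) mfield measure"
  assumes P: "canonical_law P" and R: "R > 0"
    and lip: "\<And>M N. \<bar>\<phi> M - \<phi> N\<bar> \<le> dist M N"
    and AE: "AE \<omega> in P. elliptic_field \<omega> \<and>
      dirichlet_solution \<omega> (\<lambda>x. \<phi> (\<omega> x)) (\<lambda>_. 0) (ball 0 R) (u \<omega>)"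
  shows "(\<lambda>\<omega>. u \<omega> 0) \<in> borel_measurable (completion P)"
proof (rule canonical_law_measurable_of_continuous[OF P AE compact_cball[of 0 R]])
  fix \<omega>\<^sub>0 e
  assume c: "continuous_on UNIV \<omega>\<^sub>0" and e: "(e::real) > 0"
    and Q: "elliptic_field \<omega>\<^sub>0 \<and> dirichlet_solution \<omega>\<^sub>0 (\<lambda>x. \<phi> (\<omega>\<^sub>0 x)) (\<lambda>_. 0) (ball 0 R) (u \<omega>\<^sub>0)"
  have "bounded (\<omega>\<^sub>0 ` cball 0 R)"
    by (rule compact_imp_bounded[OF compact_continuous_image[OF continuous_on_subset[OF c]]]) simp_all
  then obtain B where "\<forall>M\<in>\<omega>\<^sub>0 ` cball 0 R. norm M \<le> B"
    unfolding bounded_iff by (rule exE)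
  \<comment> \<open>Comparing with the value of \<open>\<phi>\<close> at the zero matrix supplies
    the bound on the fixed right-hand side that stability requires.\<close>
  then have bound: "\<bar>\<phi> (\<omega>\<^sub>0 x)\<bar> \<le> \<bar>\<phi> 0\<bar> + B" if "x \<in> cball 0 R" for x
    using lip[of "\<omega>\<^sub>0 x" 0] that by force
  obtain \<delta> where \<delta>: "\<delta> > 0"
    "\<And>a f v. elliptic_field a \<Longrightarrow> dirichlet_solution a f (\<lambda>_. 0) (ball 0 R) v \<Longrightarrow>
      (\<And>x. x \<in> cball 0 R \<Longrightarrow> dist (a x) (\<omega>\<^sub>0 x) < \<delta>) \<Longrightarrow>
      (\<And>x. x \<in> cball 0 R \<Longrightarrow> \<bar>f x - \<phi> (\<omega>\<^sub>0 x)\<bar> \<le> \<delta>) \<Longrightarrow> \<bar>v 0 - u \<omega>\<^sub>0 0\<bar> < e"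
    by (rule dirichlet_solution_stable[OF R e c conjunct1[OF Q] _ conjunct2[OF Q], of "\<bar>\<phi> 0\<bar> + B"])
      (use bound in simp_all)
  show "\<exists>\<delta>>0. \<forall>\<omega>. elliptic_field \<omega> \<and> dirichlet_solution \<omega> (\<lambda>x. \<phi> (\<omega> x)) (\<lambda>_. 0) (ball 0 R) (u \<omega>) \<longrightarrow>
      (\<forall>x\<in>cball 0 R. dist (\<omega> x) (\<omega>\<^sub>0 x) < \<delta>) \<longrightarrow> \<bar>u \<omega> 0 - u \<omega>\<^sub>0 0\<bar> < e"
  proof (intro exI[of _ \<delta>] conjI allI impI)
    fix \<omega>
    assume sol: "elliptic_field \<omega> \<and> dirichlet_solution \<omega> (\<lambda>x. \<phi> (\<omega> x)) (\<lambda>_. 0) (ball 0 R) (u \<omega>)"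
      and close: "\<forall>x\<in>cball 0 R. dist (\<omega> x) (\<omega>\<^sub>0 x) < \<delta>"
    show "\<bar>u \<omega> 0 - u \<omega>\<^sub>0 0\<bar> < e"
    proof (rule \<delta>(2)[OF conjunct1[OF sol] conjunct2[OF sol]])
      fix x assume x: "x \<in> cball (0 :: real ^ 'n) R"
      show "dist (\<omega> x) (\<omega>\<^sub>0 x) < \<delta>" using close x by (rule bspec)
      then show "\<bar>\<phi> (\<omega> x) - \<phi> (\<omega>\<^sub>0 x)\<bar> \<le> \<delta>" using lip[of "\<omega> x" "\<omega>\<^sub>0 x"] by linarith
    qed
  qed (rule \<delta>(1))
qed

text \<open>The error norm is a Borel function of the finitely many values of the solutions at the
  origin.\<close>

lemma A_hat_error_measurable:
  fixes P :: "('n::finite) mfield measure"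
  assumes P: "canonical_law P" and R: "R > 0" and ell: "AE \<omega> in P. elliptic_field \<omega>"
    and T: "AE \<omega> in P. dirichlet_solution \<omega> (\<lambda>_. 1) (\<lambda>_. 0) (ball 0 R) (T R \<omega>)"
    and V: "\<And>i j. AE \<omega> in P. dirichlet_solution \<omega> (\<lambda>x. \<omega> x $ i $ j) (\<lambda>_. 0) (ball 0 R) (V i j R \<omega>)"
  shows "(\<lambda>\<omega>. norm (A_hat T V R \<omega> - Abar)) \<in> borel_measurable (completion P)"
proof -
  have [measurable]: "(\<lambda>\<omega>. T R \<omega> 0) \<in> borel_measurable (completion P)"
    by (rule dirichlet_solution_measurable[where \<phi> = "\<lambda>_. 1", OF P R]) (use ell T in auto)
  have [measurable]: "(\<lambda>\<omega>. V i j R \<omega> 0) \<in> borel_measurable (completion P)" for i j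
  proof (rule dirichlet_solution_measurable[where \<phi> = "\<lambda>M. M $ i $ j", OF P R])
    show "\<bar>M $ i $ j - N $ i $ j\<bar> \<le> dist M N" for M N :: "real ^ 'n ^ 'n"
      using component_le_norm_cart[of "(M - N) $ i" j] Finite_Cartesian_Product.norm_nth_le[of "M - N" i]
      by (simp add: dist_norm)
  qed (use ell V in auto)
  have "norm (A_hat T V R \<omega> - Abar) =
      sqrt (\<Sum>i\<in>UNIV. \<Sum>j\<in>UNIV. (V i j R \<omega> 0 / T R \<omega> 0 - Abar $ i $ j)\<^sup>2)" for \<omega>
    by (simp add: norm_eq_sqrt_inner inner_mat_eq_sum A_hat_def power2_eq_square)
  then show ?thesis by simp
qed

section \<open>Transfer of the cell estimate to the effective matrix\<close>

text \<open>\<open>prob_le\<close> also asserts that its set is an event, so for \<open>E\<close>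
  this enters as an assumption beside the almost sure inclusion.\<close>

lemma prob_le_mono_AE:
  assumes "prob_space P" and F: "prob_le P F p" and E: "E \<in> sets (completion P)"
    and sub: "AE \<omega> in P. \<omega> \<in> E \<longrightarrow> \<omega> \<in> F"
  shows "prob_le P E p"
proof -
  interpret C: prob_space "completion P"
    using assms(1) by (rule prob_space.prob_space_completion)
  have "measure (completion P) E \<le> measure (completion P) F"
    using F AE_completion[OF sub] by (intro C.finite_measure_mono_AE) (auto simp: prob_le_def)
  then show ?thesis using F E by (simp add: prob_le_def)
qed

theorem corollary8p9:
  fixes P :: "('n::finite) mfield measure"
    and Abar :: "real ^ 'n ^ 'n"
    and w :: "real ^ 'n ^ 'n \<Rightarrow> real \<Rightarrow> 'n mfield \<Rightarrow> real ^ 'n \<Rightarrow> real"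
    and T :: "real \<Rightarrow> 'n mfield \<Rightarrow> real ^ 'n \<Rightarrow> real"
    and V :: "'n \<Rightarrow> 'n \<Rightarrow> real \<Rightarrow> 'n mfield \<Rightarrow> real ^ 'n \<Rightarrow> real"
    and \<delta>\<^sub>2 \<gamma>\<^sub>2 C\<^sub>2 R\<^sub>2 :: real
  assumes dim: "CARD('n) \<ge> 2"
    and canonical: "canonical_law P"
    and H1: "elliptic_law P"
    and H2: "stationary_law P"
    and H3: "finite_range_law P"
    and H4: "regular_law P"
    and H5: "ellipticity_moment P"
    and Abar: "effective_matrix P Abar"
    and params: "0 < \<delta>\<^sub>2" "\<delta>\<^sub>2 < 1" "0 < \<gamma>\<^sub>2"
    and w: "AE \<omega> in P. \<forall>R>0. \<forall>M\<in>sym_mat.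
              dirichlet_solution \<omega> (\<lambda>x. (\<omega> x - Abar) \<bullet> M) (\<lambda>_. 0) (ball 0 R) (w M R \<omega>)"
    and cell: "\<And>R. R > 0 \<Longrightarrow> R \<ge> R\<^sub>2 \<Longrightarrow>
              prob_le P {\<omega> \<in> space P. cell_error w R \<omega> > C\<^sub>2 * R powr (- \<delta>\<^sub>2)} (C\<^sub>2 * R powr (- \<gamma>\<^sub>2))"
    and T: "AE \<omega> in P. \<forall>R>0.
              dirichlet_solution \<omega> (\<lambda>_. 1) (\<lambda>_. 0) (ball 0 R) (T R \<omega>)"
    and V: "AE \<omega> in P. \<forall>R>0. \<forall>i j.
              dirichlet_solution \<omega> (\<lambda>x. \<omega> x $ i $ j) (\<lambda>_. 0) (ball 0 R) (V i j R \<omega>)"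
  shows "\<forall>R. R > 0 \<and> R \<ge> R\<^sub>2 \<longrightarrow>
           prob_le P {\<omega> \<in> space P. norm (A_hat T V R \<omega> - Abar) > 2 * real CARD('n) * C\<^sub>2 * R powr (- \<delta>\<^sub>2)}
             (C\<^sub>2 * R powr (- \<gamma>\<^sub>2))"
proof (intro allI impI, elim conjE)
  fix R :: real
  assume R: "R > 0" "R \<ge> R\<^sub>2"
  have ell: "AE \<omega> in P. elliptic_field \<omega>"
    using H1 by (simp add: elliptic_law_def elliptic_field_def)
  have T: "AE \<omega> in P. dirichlet_solution \<omega> (\<lambda>_. 1) (\<lambda>_. 0) (ball 0 R) (T R \<omega>)"
    using T R(1) by (auto elim: eventually_mono)
  have V: "AE \<omega> in P. \<forall>i j. dirichlet_solution \<omega> (\<lambda>x. \<omega> x $ i $ j) (\<lambda>_. 0) (ball 0 R) (V i j R \<omega>)"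
    using V R(1) by (auto elim: eventually_mono)
  let ?E = "{\<omega> \<in> space P. norm (A_hat T V R \<omega> - Abar) > 2 * real CARD('n) * C\<^sub>2 * R powr (- \<delta>\<^sub>2)}"
  let ?F = "{\<omega> \<in> space P. cell_error w R \<omega> > C\<^sub>2 * R powr (- \<delta>\<^sub>2)}"
  show "prob_le P ?E (C\<^sub>2 * R powr (- \<gamma>\<^sub>2))"
  proof (rule prob_le_mono_AE[OF _ cell[OF R]])
    show "prob_space P" using canonical by (simp add: canonical_law_def)
    have [measurable]: "(\<lambda>\<omega>. norm (A_hat T V R \<omega> - Abar)) \<in> borel_measurable (completion P)"
      using V by (intro A_hat_error_measurable[where T = T, OF canonical R(1) ell T]) (auto elim: eventually_mono)
    have "{\<omega> \<in> space (completion P). norm (A_hat T V R \<omega> - Abar) > 2 * real CARD('n) * C\<^sub>2 * R powr (- \<delta>\<^sub>2)}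
        \<in> sets (completion P)"
      by measurable
    then show "?E \<in> sets (completion P)" by (simp only: space_completion)
    \<comment> \<open>Off a null set all solutions exist as prescribed, and the deterministic bound
      places the matrix event inside the cell event.\<close>
    show "AE \<omega> in P. \<omega> \<in> ?E \<longrightarrow> \<omega> \<in> ?F"
      using ell w T V
    proof eventually_elim
      case (elim \<omega>)
      have le: "norm (A_hat T V R \<omega> - Abar) \<le> 2 * real CARD('n) * cell_error w R \<omega>"
      proof (rule norm_A_hat_diff_le[OF elim(1) R(1)])
        show "dirichlet_solution \<omega> (\<lambda>_. 1) (\<lambda>_. 0) (ball 0 R) (T R \<omega>)" by (rule elim(3))
        show "Abar \<in> sym_mat" using Abar unfolding effective_matrix_def by (rule conjunct1)
        show "dirichlet_solution \<omega> (\<lambda>x. (\<omega> x - Abar) \<bullet> M) (\<lambda>_. 0) (ball 0 R) (w M R \<omega>)"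
          if "M \<in> sym_mat" for M
          using elim(2) R(1) that by simp
        show "dirichlet_solution \<omega> (\<lambda>x. \<omega> x $ i $ j) (\<lambda>_. 0) (ball 0 R) (V i j R \<omega>)" for i j
          using elim(4) by simp
      qed
      show ?case
      proof
        assume "\<omega> \<in> ?E"
        then have "\<omega> \<in> space P"
          and "2 * real CARD('n) * C\<^sub>2 * R powr (- \<delta>\<^sub>2) < norm (A_hat T V R \<omega> - Abar)"
          unfolding mem_Collect_eq by (rule conjunct1, rule conjunct2)
        note less = less_le_trans[OF this(2) le]
        have "0 < 2 * real CARD('n)" by simp
        from less have "C\<^sub>2 * R powr (- \<delta>\<^sub>2) < cell_error w R \<omega>"
          \<comment> \<open>Rebracketing exposes \<open>2 * real CARD('n)\<close> as a common
            positive left factor, which is then cancelled.\<close>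
          unfolding mult.assoc[of "2 * real CARD('n)"] mult_less_cancel_left_pos[OF \<open>0 < 2 * real CARD('n)\<close>] .
        with \<open>\<omega> \<in> space P\<close> show "\<omega> \<in> ?F"
          unfolding mem_Collect_eq by (rule conjI)
      qed
    qed
  qed
qed

end
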